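(* The set of sequences $\{\gamma_\eta\colon \eta\in\mathfrak{M}_{\mathbb{C}}\}$ is a dense subset of $\operatorname{BUC}(\mathbb{N}_0,d_{\log})$. Moreover, the C*-subalgebra of $\ell_\infty(\mathbb{N}_0)$ generated by $\{\gamma_\eta\colon\eta\in\mathfrak{M}_{\mathbb{C}}\}$ coincides with $\operatorname{BUC}(\mathbb{N}_0,d_{\log})$.
   Context: $\mathbb{N}_0=\{0,1,2,\ldots\}$. For a positive finite Borel measure $\eta$ on $[0,1)$ let $\varkappa_\eta(r)=\frac{2\,\eta([r,1))}{1-r^2}$, $r\in[0,1)$. $\mathfrak{M}_{\mathbb{C}}$ is the set of all finite complex Borel measures $\eta$ on $[0,1)$ of the form $\eta=\eta_1-\eta_2+\mathrm{i}(\eta_3-\eta_4)$, where $\eta_1,\eta_2,\eta_3,\eta_4$ are positive finite Borel measures on $[0,1)$ such that each $\varkappa_{\eta_j}$ is a bounded function. For $\eta\in\mathfrak{M}_{\mathbb{C}}$, $\gamma_\eta(k)=2(k+1)\int_{[0,1)}r^{2k}\,\mathrm{d}\eta(r)$, $k\in\mathbb{N}_0$. The logarithmic distance on $\mathbb{N}_0$ is $d_{\log}(m,n)=|\log(m+1)-\log(n+1)|$. $\operatorname{BUC}(\mathbb{N}_0,d_{\log})$ is the set of all bounded complex sequences on $\mathbb{N}_0$ that are uniformly continuous with respect to $d_{\log}$; it is considered as a subset of the C*-algebra $\ell_\infty(\mathbb{N}_0)$ with pointwise operations and the supremum norm, and density is with respect to this norm. *)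

theory Defs
  imports "HOL-Analysis.Analysis"
begin

section \<open>Measures on the half-open unit interval\<close>

abbreviation borel01 :: "real measure"
  where "borel01 \<equiv> restrict_space borel {0..<1}"

definition positive_finite_borel01 :: "real measure \<Rightarrow> bool"
  where "positive_finite_borel01 \<mu> \<longleftrightarrow> sets \<mu> = sets borel01 \<and> finite_measure \<mu>"

text \<open>
  The distribution has no type of complex measures.  A finite complex Borel measure on
  $[0,1)$ is represented by a countably additive set function.  It is fixed to be 0 on the sets
  outside the sigma-algebra, so that each complex measure has exactly one representative.
\<close>

definition complex_borel01 :: "(real set \<Rightarrow> complex) \<Rightarrow> bool"
  where "complex_borel01 \<eta> \<longleftrightarrow>
    (\<forall>A. A \<notin> sets borel01 \<longrightarrow> \<eta> A = 0) \<and>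
    (\<forall>A :: nat \<Rightarrow> real set. range A \<subseteq> sets borel01 \<and> disjoint_family A \<longrightarrow>
       (\<lambda>i. \<eta> (A i)) sums \<eta> (\<Union>i. A i))"

definition decomposes ::
    "(real set \<Rightarrow> complex) \<Rightarrow> real measure \<Rightarrow> real measure \<Rightarrow> real measure \<Rightarrow> real measure \<Rightarrow> bool"
  where "decomposes \<eta> \<eta>1 \<eta>2 \<eta>3 \<eta>4 \<longleftrightarrow>
    positive_finite_borel01 \<eta>1 \<and> positive_finite_borel01 \<eta>2 \<and>
    positive_finite_borel01 \<eta>3 \<and> positive_finite_borel01 \<eta>4 \<and>
    (\<forall>A\<in>sets borel01. \<eta> A =
       of_real (measure \<eta>1 A) - of_real (measure \<eta>2 A) +
       \<i> * (of_real (measure \<eta>3 A) - of_real (measure \<eta>4 A)))"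

text \<open>
  The integral against a complex measure is the corresponding combination of the integrals against
  the parts of a decomposition into positive finite measures.  For bounded Borel functions it does
  not depend on the decomposition: see \<open>complex_integral_eq\<close> below.
\<close>

definition complex_integral :: "(real set \<Rightarrow> complex) \<Rightarrow> (real \<Rightarrow> complex) \<Rightarrow> complex"
  where "complex_integral \<eta> f =
    (THE z. \<exists>\<eta>1 \<eta>2 \<eta>3 \<eta>4. decomposes \<eta> \<eta>1 \<eta>2 \<eta>3 \<eta>4 \<and>
       z = (LINT r|\<eta>1. f r) - (LINT r|\<eta>2. f r) + \<i> * ((LINT r|\<eta>3. f r) - (LINT r|\<eta>4. f r)))"

lemma nn_integral_cross:
  assumes s: "sets a = sets M" "sets b = sets M" "sets c = sets M" "sets d = sets M"
    and eq: "\<And>A. A \<in> sets M \<Longrightarrow> emeasure a A + emeasure b A = emeasure c A + emeasure d A"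
    and f: "f \<in> borel_measurable M"
  shows "(\<integral>\<^sup>+x. f x \<partial>a) + (\<integral>\<^sup>+x. f x \<partial>b) = (\<integral>\<^sup>+x. f x \<partial>c) + (\<integral>\<^sup>+x. f x \<partial>d)"
  using f
proof (induction rule: borel_measurable_induct)
  case (cong f g)
  then show ?case
    by (smt (verit, best) nn_integral_cong s sets_eq_imp_space_eq)
next
  case (set A)
  then show ?case
    using s eq by simp
next
  case (mult u k)
  have "u \<in> borel_measurable a" "u \<in> borel_measurable b" "u \<in> borel_measurable c" "u \<in> borel_measurable d"
    using mult s by (auto cong: measurable_cong_sets)
  then show ?case
    using mult by (simp add: nn_integral_cmult flip: distrib_left)
next
  case (add u v)
  have "u \<in> borel_measurable a" "u \<in> borel_measurable b" "u \<in> borel_measurable c" "u \<in> borel_measurable d"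
    "v \<in> borel_measurable a" "v \<in> borel_measurable b" "v \<in> borel_measurable c" "v \<in> borel_measurable d"
    using add s by (auto cong: measurable_cong_sets)
  then have "(\<integral>\<^sup>+x. v x + u x \<partial>a) + (\<integral>\<^sup>+x. v x + u x \<partial>b)
      = ((\<integral>\<^sup>+x. v x \<partial>a) + (\<integral>\<^sup>+x. v x \<partial>b)) + ((\<integral>\<^sup>+x. u x \<partial>a) + (\<integral>\<^sup>+x. u x \<partial>b))"
    and "(\<integral>\<^sup>+x. v x + u x \<partial>c) + (\<integral>\<^sup>+x. v x + u x \<partial>d)
      = ((\<integral>\<^sup>+x. v x \<partial>c) + (\<integral>\<^sup>+x. v x \<partial>d)) + ((\<integral>\<^sup>+x. u x \<partial>c) + (\<integral>\<^sup>+x. u x \<partial>d))"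
    by (simp_all add: nn_integral_add ac_simps)
  then show ?case
    using add by simp
next
  case (seq U)
  have U: "U i \<in> borel_measurable a" "U i \<in> borel_measurable b" "U i \<in> borel_measurable c"
      "U i \<in> borel_measurable d" for i
    using seq s by (auto cong: measurable_cong_sets)
  have inc: "incseq (\<lambda>i. \<integral>\<^sup>+x. U i x \<partial>N)" for N :: "'a measure"
    using seq by (auto simp: incseq_def le_fun_def intro!: nn_integral_mono)
  have lim: "(\<integral>\<^sup>+x. (SUP i. U i) x \<partial>N) = (SUP i. \<integral>\<^sup>+x. U i x \<partial>N)"
    if "\<And>i. U i \<in> borel_measurable N" for N
    using seq that nn_integral_monotone_convergence_SUP[of U N] by (simp add: image_comp)
  show ?case
    using lim[OF U(1)] lim[OF U(2)] lim[OF U(3)] lim[OF U(4)] seq inc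
    by (simp flip: ennreal_SUP_add)
qed

lemma integral_cross_nonneg:
  fixes f :: "real \<Rightarrow> real"
  assumes p: "positive_finite_borel01 a" "positive_finite_borel01 b"
      "positive_finite_borel01 c" "positive_finite_borel01 d"
    and eq: "\<And>A. A \<in> sets borel01 \<Longrightarrow> measure a A + measure b A = measure c A + measure d A"
    and f: "f \<in> borel_measurable borel01" "\<And>x. 0 \<le> f x" "\<And>x. f x \<le> B"
  shows "(LINT x|a. f x) + (LINT x|b. f x) = (LINT x|c. f x) + (LINT x|d. f x)"
proof -
  have s: "sets a = sets borel01" "sets b = sets borel01" "sets c = sets borel01" "sets d = sets borel01"
    using p by (auto simp: positive_finite_borel01_def)
  have em: "emeasure N A = ennreal (measure N A)" if "positive_finite_borel01 N" for N A
    using that by (simp add: positive_finite_borel01_def finite_measure.emeasure_eq_measure)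
  have nn: "(\<integral>\<^sup>+x. ennreal (f x) \<partial>N) = ennreal (LINT x|N. f x)" if "positive_finite_borel01 N" for N
  proof (rule nn_integral_eq_integral)
    have "f \<in> borel_measurable N"
      using that f(1) by (auto simp: positive_finite_borel01_def cong: measurable_cong_sets)
    then show "integrable N f"
      using that f by (intro finite_measure.integrable_const_bound[where B=B])
        (auto simp: positive_finite_borel01_def)
  qed (use f in auto)
  have "(\<integral>\<^sup>+x. ennreal (f x) \<partial>a) + (\<integral>\<^sup>+x. ennreal (f x) \<partial>b)
      = (\<integral>\<^sup>+x. ennreal (f x) \<partial>c) + (\<integral>\<^sup>+x. ennreal (f x) \<partial>d)"
    by (rule nn_integral_cross[OF s])
      (use eq f in \<open>auto simp: em p simp flip: ennreal_plus\<close>)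
  then show ?thesis
    using f by (simp add: nn p integral_nonneg_AE flip: ennreal_plus)
qed

lemma integrable_bounded_borel01:
  fixes f :: "real \<Rightarrow> 'a::{banach, second_countable_topology}"
  assumes "positive_finite_borel01 N" "f \<in> borel_measurable borel01" "\<And>x. norm (f x) \<le> B"
  shows "integrable N f"
proof -
  have "f \<in> borel_measurable N"
    using assms by (auto simp: positive_finite_borel01_def cong: measurable_cong_sets)
  then show ?thesis
    using assms by (intro finite_measure.integrable_const_bound[where B=B])
      (auto simp: positive_finite_borel01_def)
qed

lemma integral_cross_real:
  fixes f :: "real \<Rightarrow> real"
  assumes p: "positive_finite_borel01 a" "positive_finite_borel01 b"
      "positive_finite_borel01 c" "positive_finite_borel01 d"
    and eq: "\<And>A. A \<in> sets borel01 \<Longrightarrow> measure a A + measure b A = measure c A + measure d A"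
    and f: "f \<in> borel_measurable borel01" "\<And>x. \<bar>f x\<bar> \<le> B"
  shows "(LINT x|a. f x) + (LINT x|b. f x) = (LINT x|c. f x) + (LINT x|d. f x)"
proof -
  have m: "(\<lambda>x. max 0 (f x)) \<in> borel_measurable borel01" "(\<lambda>x. max 0 (- f x)) \<in> borel_measurable borel01"
    using f(1) by simp_all
  have bd: "max 0 (f x) \<le> \<bar>B\<bar>" "max 0 (- f x) \<le> \<bar>B\<bar>" for x
    using f(2)[of x] by auto
  have split: "(LINT x|N. f x) = (LINT x|N. max 0 (f x)) - (LINT x|N. max 0 (- f x))"
    if "positive_finite_borel01 N" for N
  proof -
    have "integrable N (\<lambda>x. max 0 (f x))" "integrable N (\<lambda>x. max 0 (- f x))"
      using bd by (auto intro!: integrable_bounded_borel01[OF that, where B="\<bar>B\<bar>"] m)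
    then have "(LINT x|N. max 0 (f x)) - (LINT x|N. max 0 (- f x))
        = (LINT x|N. max 0 (f x) - max 0 (- f x))"
      by simp
    also have "\<dots> = (LINT x|N. f x)"
      by (rule Bochner_Integration.integral_cong) auto
    finally show ?thesis by simp
  qed
  have 1: "(LINT x|a. max 0 (f x)) + (LINT x|b. max 0 (f x))
      = (LINT x|c. max 0 (f x)) + (LINT x|d. max 0 (f x))"
    by (rule integral_cross_nonneg[OF p eq m(1) _ bd(1)]) auto
  have 2: "(LINT x|a. max 0 (- f x)) + (LINT x|b. max 0 (- f x))
      = (LINT x|c. max 0 (- f x)) + (LINT x|d. max 0 (- f x))"
    by (rule integral_cross_nonneg[OF p eq m(2) _ bd(2)]) auto
  show ?thesis
    using 1 2 p by (simp add: split)
qed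

lemma integral_cross_complex:
  fixes f :: "real \<Rightarrow> complex"
  assumes p: "positive_finite_borel01 a" "positive_finite_borel01 b"
      "positive_finite_borel01 c" "positive_finite_borel01 d"
    and eq: "\<And>A. A \<in> sets borel01 \<Longrightarrow> measure a A + measure b A = measure c A + measure d A"
    and f: "f \<in> borel_measurable borel01" "bounded (f ` {0..<1})"
  shows "(LINT x|a. f x) + (LINT x|b. f x) = (LINT x|c. f x) + (LINT x|d. f x)"
proof -
  obtain B where B: "\<And>x. x \<in> {0..<1} \<Longrightarrow> norm (f x) \<le> B"
    using f(2) unfolding bounded_iff by blast
  define g where "g x = (if x \<in> {0..<1} then f x else 0)" for x
  have g: "g \<in> borel_measurable borel01" "norm (g x) \<le> \<bar>B\<bar>" for x
  proof -
    have "g \<in> borel_measurable borel01 \<longleftrightarrow> f \<in> borel_measurable borel01"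
      by (rule measurable_cong) (simp add: g_def space_restrict_space)
    then show "g \<in> borel_measurable borel01"
      using f(1) by simp
    show "norm (g x) \<le> \<bar>B\<bar>"
      using B[of x] by (auto simp: g_def)
  qed
  have fg: "(LINT x|N. f x) = (LINT x|N. g x)" if "positive_finite_borel01 N" for N
  proof (rule Bochner_Integration.integral_cong)
    have "space N = {0..<1}"
      using that sets_eq_imp_space_eq[of N borel01]
      by (simp add: positive_finite_borel01_def space_restrict_space)
    then show "f x = g x" if "x \<in> space N" for x
      using that by (simp add: g_def)
  qed simp
  have m: "(\<lambda>x. Re (g x)) \<in> borel_measurable borel01" "(\<lambda>x. Im (g x)) \<in> borel_measurable borel01"
    using g(1) by simp_all
  have b: "\<bar>Re (g x)\<bar> \<le> \<bar>B\<bar>" "\<bar>Im (g x)\<bar> \<le> \<bar>B\<bar>" for x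
    using g(2)[of x] abs_Re_le_cmod[of "g x"] abs_Im_le_cmod[of "g x"] by linarith+
  have i: "integrable N g" if "positive_finite_borel01 N" for N
    by (rule integrable_bounded_borel01[OF that g])
  show ?thesis
    using integral_cross_real[OF p eq m(1) b(1)] integral_cross_real[OF p eq m(2) b(2)] p
    by (simp add: fg complex_eq_iff i flip: integral_Re integral_Im)
qed

lemma complex_integral_eq:
  assumes dec: "decomposes \<eta> \<eta>1 \<eta>2 \<eta>3 \<eta>4"
    and f: "f \<in> borel_measurable borel01" "bounded (f ` {0..<1})"
  shows "complex_integral \<eta> f =
    (LINT r|\<eta>1. f r) - (LINT r|\<eta>2. f r) + \<i> * ((LINT r|\<eta>3. f r) - (LINT r|\<eta>4. f r))"
  unfolding complex_integral_def
proof (rule the_equality)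
  fix z
  assume "\<exists>\<mu>1 \<mu>2 \<mu>3 \<mu>4. decomposes \<eta> \<mu>1 \<mu>2 \<mu>3 \<mu>4 \<and>
    z = (LINT r|\<mu>1. f r) - (LINT r|\<mu>2. f r) + \<i> * ((LINT r|\<mu>3. f r) - (LINT r|\<mu>4. f r))"
  then obtain \<mu>1 \<mu>2 \<mu>3 \<mu>4 where d: "decomposes \<eta> \<mu>1 \<mu>2 \<mu>3 \<mu>4"
    and z: "z = (LINT r|\<mu>1. f r) - (LINT r|\<mu>2. f r) + \<i> * ((LINT r|\<mu>3. f r) - (LINT r|\<mu>4. f r))"
    by blast
  have m: "measure \<mu>1 A + measure \<eta>2 A = measure \<eta>1 A + measure \<mu>2 A"
    "measure \<mu>3 A + measure \<eta>4 A = measure \<eta>3 A + measure \<mu>4 A" if "A \<in> sets borel01" for A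
  proof -
    have e: "complex_of_real (measure \<mu>1 A) - of_real (measure \<mu>2 A) +
        \<i> * (of_real (measure \<mu>3 A) - of_real (measure \<mu>4 A))
      = of_real (measure \<eta>1 A) - of_real (measure \<eta>2 A) +
        \<i> * (of_real (measure \<eta>3 A) - of_real (measure \<eta>4 A))"
      using dec d that unfolding decomposes_def by metis
    show "measure \<mu>1 A + measure \<eta>2 A = measure \<eta>1 A + measure \<mu>2 A"
      using arg_cong[OF e, of Re] by simp
    show "measure \<mu>3 A + measure \<eta>4 A = measure \<eta>3 A + measure \<mu>4 A"
      using arg_cong[OF e, of Im] by simp
  qed
  have p: "positive_finite_borel01 \<eta>1" "positive_finite_borel01 \<eta>2" "positive_finite_borel01 \<eta>3"
    "positive_finite_borel01 \<eta>4" "positive_finite_borel01 \<mu>1" "positive_finite_borel01 \<mu>2"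
    "positive_finite_borel01 \<mu>3" "positive_finite_borel01 \<mu>4"
    using dec d by (auto simp: decomposes_def)
  have 1: "(LINT r|\<mu>1. f r) - (LINT r|\<mu>2. f r) = (LINT r|\<eta>1. f r) - (LINT r|\<eta>2. f r)"
    using integral_cross_complex[OF p(5) p(2) p(1) p(6) m(1) f] by (simp add: algebra_simps)
  have 2: "(LINT r|\<mu>3. f r) - (LINT r|\<mu>4. f r) = (LINT r|\<eta>3. f r) - (LINT r|\<eta>4. f r)"
    using integral_cross_complex[OF p(7) p(4) p(3) p(8) m(2) f] by (simp add: algebra_simps)
  show "z = (LINT r|\<eta>1. f r) - (LINT r|\<eta>2. f r) + \<i> * ((LINT r|\<eta>3. f r) - (LINT r|\<eta>4. f r))"
    using z 1 2 by simp
qed (use dec in blast)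


section \<open>The class of measures and the sequences\<close>

definition kappa :: "real measure \<Rightarrow> real \<Rightarrow> real"
  where "kappa \<eta> r = 2 * measure \<eta> {r..<1} / (1 - r\<^sup>2)"

definition M_C :: "(real set \<Rightarrow> complex) set"
  where "M_C = {\<eta>. complex_borel01 \<eta> \<and>
    (\<exists>\<eta>1 \<eta>2 \<eta>3 \<eta>4. decomposes \<eta> \<eta>1 \<eta>2 \<eta>3 \<eta>4 \<and>
       (\<forall>\<mu>\<in>{\<eta>1, \<eta>2, \<eta>3, \<eta>4}. bounded (kappa \<mu> ` {0..<1})))}"

definition gamma_seq :: "(real set \<Rightarrow> complex) \<Rightarrow> nat \<Rightarrow> complex"
  where "gamma_seq \<eta> k = 2 * (of_nat k + 1) * complex_integral \<eta> (\<lambda>r. of_real (r ^ (2 * k)))"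


section \<open>Bounded sequences\<close>

text \<open>The bounded complex sequences, with the supremum distance.\<close>

definition linf :: "(nat \<Rightarrow> complex) metric"
  where "linf = funspace UNIV euclidean_metric"

lemma mspace_linf: "mspace linf = {f. bounded (range f)}"
proof -
  have "Metric_space.mbounded UNIV (dist :: complex \<Rightarrow> complex \<Rightarrow> real) S \<longleftrightarrow> bounded S" for S
    by (auto simp: Met_TC.mbounded_def bounded_def subset_iff)
  then show ?thesis
    by (auto simp: linf_def Met_TC.fspace_def)
qed

lemma mdist_linf:
  "f \<in> mspace linf \<Longrightarrow> g \<in> mspace linf \<Longrightarrow> mdist linf f g = (SUP k. cmod (f k - g k))"
  by (simp add: linf_def Met_TC.fdist_def dist_norm)

definition d_log :: "nat \<Rightarrow> nat \<Rightarrow> real"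
  where "d_log m n = \<bar>ln (real m + 1) - ln (real n + 1)\<bar>"

lemma Metric_space_d_log: "Metric_space UNIV d_log"
  by unfold_locales (auto simp: d_log_def)

definition BUC :: "(nat \<Rightarrow> complex) set"
  where "BUC = {f \<in> mspace linf. uniformly_continuous_map (metric (UNIV, d_log)) euclidean_metric f}"

lemma BUC_iff:
  "f \<in> BUC \<longleftrightarrow> bounded (range f) \<and>
    (\<forall>\<epsilon>>0. \<exists>\<delta>>0. \<forall>m n. d_log m n < \<delta> \<longrightarrow> cmod (f m - f n) < \<epsilon>)"
proof -
  have "d_log m n = d_log n m" for m n
    by (simp add: d_log_def abs_minus_commute)
  then show ?thesis
    unfolding BUC_def mspace_linf uniformly_continuous_map_def
    by (simp add: dist_norm norm_minus_commute Metric_space.mspace_metric[OF Metric_space_d_log]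
        Metric_space.mdist_metric[OF Metric_space_d_log])
qed

text \<open>C*-subalgebras are not required to contain the unit.\<close>

definition cstar_subalgebra :: "(nat \<Rightarrow> complex) set \<Rightarrow> bool"
  where "cstar_subalgebra A \<longleftrightarrow>
    A \<subseteq> mspace linf \<and>
    (\<lambda>k. 0) \<in> A \<and>
    (\<forall>f\<in>A. \<forall>g\<in>A. (\<lambda>k. f k + g k) \<in> A) \<and>
    (\<forall>f\<in>A. \<forall>g\<in>A. (\<lambda>k. f k * g k) \<in> A) \<and>
    (\<forall>c. \<forall>f\<in>A. (\<lambda>k. c * f k) \<in> A) \<and>
    (\<forall>f\<in>A. (\<lambda>k. cnj (f k)) \<in> A) \<and>
    closedin (mtopology_of linf) A"

text \<open>Meaningful for sets of bounded sequences only.\<close>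

definition cstar_generated :: "(nat \<Rightarrow> complex) set \<Rightarrow> (nat \<Rightarrow> complex) set"
  where "cstar_generated X = \<Inter> {A. cstar_subalgebra A \<and> X \<subseteq> A}"

end

theory Submission
  imports Defs
begin

text \<open>
  Membership in BUC: for a positive measure with bounded $\varkappa_\eta$ the moments
  $M_k = \int r^{2k}\,d\eta$ are $O(1/(k+1))$.  They are convex in $k$, so $M_k - M_{k+1}$ is
  $O(1/(k+1)^2)$; hence $\gamma_\eta$ has increments $O(1/(k+1))$ and is Lipschitz for the
  logarithmic distance.

  Density: given $f$ in BUC, put $h(t) = f(n - 1)$ with $n$ the integer nearest to $1/t$.  For the
  density $\sum_j c_j \frac{r}{j+1} h(-2 \ln r/(j+1))$, the substitution $v = r^{2(k+1)/(j+1)}$ gives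
  \[ \gamma(k) = \int_0^1 p(v)\, h(-\ln v/(k+1))\,dv, \qquad p(v) = \sum_j c_j v^j. \]
  If $p$ is a polynomial approximate identity concentrated at $v = 1/e$, where
  $h(-\ln v/(k+1)) = f(k)$, the integral is uniformly close to $f(k)$.
\<close>

section \<open>The space BUC\<close>

text \<open>The obstacle to density is that one measure has to serve every \<open>k\<close>. For a
  density r h(-2 ln r), \<open>gamma_seq\<close> at \<open>k\<close> is the mean of h(-ln v/(k+1))
  over v in (0,1), a multiplicative convolution of h with a fixed kernel that does not sharpen as
  \<open>k\<close> grows. Dilating h, however, inserts a weight v^j into this mean, so linear
  combinations of dilates realise every polynomial weight, and polynomials include approximate
  identities at any interior point. This explicit construction does the work of a Wiener-type
  density theorem. The error is uniform in \<open>k\<close> because h is read at a point whose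
  reciprocal is k+1 times -1/ln v: moving v away from 1/e changes the index by a factor that is
  independent of \<open>k\<close>, up to rounding, and the logarithmic distance measures exactly
  such factors. The statement on the generated algebra then follows by a sandwich: BUC is itself a
  C*-subalgebra containing the sequences, and every C*-subalgebra containing them is closed, so it
  contains their closure.\<close>

lemma closure_of_linf:
  "mtopology_of linf closure_of S =
    {f \<in> mspace linf. \<forall>r>0. \<exists>g\<in>S. g \<in> mspace linf \<and> mdist linf f g < r}"
proof -
  interpret Metric_space "mspace linf" "mdist linf"
    by (rule Metric_space_mspace_mdist)
  show ?thesis
    unfolding mtopology_of_def metric_closure_of by (auto simp: in_mball)
qed

lemma bdd_above_cmod_diff:
  assumes "f \<in> mspace linf" "g \<in> mspace linf"
  shows "bdd_above (range (\<lambda>k. cmod (f k - g k)))"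
proof -
  have "bounded (range (\<lambda>k. f k - g k))"
    using assms by (intro bounded_minus_comp) (auto simp: mspace_linf)
  then show ?thesis
    by (auto simp: bounded_iff bdd_above_def)
qed

lemma cmod_diff_le_mdist_linf:
  assumes "f \<in> mspace linf" "g \<in> mspace linf"
  shows "cmod (f k - g k) \<le> mdist linf f g"
  unfolding mdist_linf[OF assms] by (rule cSUP_upper[OF UNIV_I bdd_above_cmod_diff[OF assms]])

lemma mdist_linf_le:
  assumes "f \<in> mspace linf" "g \<in> mspace linf" "\<And>k. cmod (f k - g k) \<le> r"
  shows "mdist linf f g \<le> r"
  unfolding mdist_linf[OF assms(1,2)] using assms(3) by (intro cSUP_least) auto

text \<open>The bound is taken strictly positive because \<open>BUC_mult\<close> and
  \<open>gamma_seq_approx\<close> divide by it.\<close>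

lemma BUC_bounded: "f \<in> BUC \<Longrightarrow> \<exists>B>0. \<forall>k. cmod (f k) \<le> B"
  unfolding BUC_iff bounded_pos by auto

lemma BUC_I:
  assumes "\<And>k. cmod (f k) \<le> B"
    and "\<And>\<epsilon>. \<epsilon> > 0 \<Longrightarrow> \<exists>\<delta>>0. \<forall>m n. d_log m n < \<delta> \<longrightarrow> cmod (f m - f n) < \<epsilon>"
  shows "f \<in> BUC"
  unfolding BUC_iff bounded_iff using assms by auto

lemma BUC_lipschitz:
  assumes "\<And>k. cmod (f k) \<le> B" "\<And>m n. cmod (f m - f n) \<le> L * d_log m n"
  shows "f \<in> BUC"
proof (rule BUC_I[OF assms(1)])
  fix \<epsilon> :: real assume e: "\<epsilon> > 0"
  \<comment> \<open>Dividing by \<open>\<bar>L\<bar> + 1\<close> covers \<open>L = 0\<close> and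
    needs no sign condition on \<open>L\<close>.\<close>
  have "cmod (f m - f n) < \<epsilon>" if "d_log m n < \<epsilon> / (\<bar>L\<bar> + 1)" for m n
  proof -
    have "cmod (f m - f n) \<le> L * d_log m n" by (rule assms)
    also have "\<dots> \<le> (\<bar>L\<bar> + 1) * d_log m n"
      by (intro mult_right_mono) (auto simp: d_log_def)
    also have "\<dots> < \<epsilon>"
      using that by (simp add: pos_less_divide_eq mult.commute)
    finally show ?thesis .
  qed
  then show "\<exists>\<delta>>0. \<forall>m n. d_log m n < \<delta> \<longrightarrow> cmod (f m - f n) < \<epsilon>"
    using e by (intro exI[of _ "\<epsilon> / (\<bar>L\<bar> + 1)"]) auto
qed

lemma BUC_add:
  assumes f: "f \<in> BUC" and g: "g \<in> BUC"
  shows "(\<lambda>k. f k + g k) \<in> BUC"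
proof -
  obtain B C where B: "\<And>k. cmod (f k) \<le> B" and C: "\<And>k. cmod (g k) \<le> C"
    using BUC_bounded[OF f] BUC_bounded[OF g] by auto
  show ?thesis
  proof (rule BUC_I)
    show "cmod (f k + g k) \<le> B + C" for k
      using norm_triangle_mono[OF B C] .
    fix \<epsilon> :: real assume e: "\<epsilon> > 0"
    obtain d1 where d1: "d1 > 0" "\<And>m n. d_log m n < d1 \<Longrightarrow> cmod (f m - f n) < \<epsilon> / 2"
      using f e half_gt_zero[OF e] unfolding BUC_iff by meson
    obtain d2 where d2: "d2 > 0" "\<And>m n. d_log m n < d2 \<Longrightarrow> cmod (g m - g n) < \<epsilon> / 2"
      using g e half_gt_zero[OF e] unfolding BUC_iff by meson
    have "cmod (f m + g m - (f n + g n)) < \<epsilon>" if "d_log m n < min d1 d2" for m n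
      using d1(2)[of m n] d2(2)[of m n] that norm_diff_triangle_ineq[of "f m" "g m" "f n" "g n"] by simp
    then show "\<exists>\<delta>>0. \<forall>m n. d_log m n < \<delta> \<longrightarrow> cmod (f m + g m - (f n + g n)) < \<epsilon>"
      using d1(1) d2(1) by (intro exI[of _ "min d1 d2"]) auto
  qed
qed

lemma BUC_mult:
  assumes f: "f \<in> BUC" and g: "g \<in> BUC"
  shows "(\<lambda>k. f k * g k) \<in> BUC"
proof -
  obtain B C where B: "B > 0" "\<And>k. cmod (f k) \<le> B" and C: "C > 0" "\<And>k. cmod (g k) \<le> C"
    using BUC_bounded[OF f] BUC_bounded[OF g] by auto
  show ?thesis
  proof (rule BUC_I)
    show "cmod (f k * g k) \<le> B * C" for k
      using B C by (simp add: norm_mult mult_mono less_imp_le)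
    fix \<epsilon> :: real assume e: "\<epsilon> > 0"
    have e1: "\<epsilon> / (2 * C) > 0" and e2: "\<epsilon> / (2 * B) > 0"
      using e B C by auto
    obtain d1 where d1: "d1 > 0" "\<And>m n. d_log m n < d1 \<Longrightarrow> cmod (f m - f n) < \<epsilon> / (2 * C)"
      using f e1 unfolding BUC_iff by meson
    obtain d2 where d2: "d2 > 0" "\<And>m n. d_log m n < d2 \<Longrightarrow> cmod (g m - g n) < \<epsilon> / (2 * B)"
      using g e2 unfolding BUC_iff by meson
    have "cmod (f m * g m - f n * g n) < \<epsilon>" if "d_log m n < min d1 d2" for m n
    proof -
      have "cmod (f m * g m - f n * g n) = cmod ((f m - f n) * g m + f n * (g m - g n))"
        by (simp add: algebra_simps)
      also have "\<dots> \<le> cmod (f m - f n) * cmod (g m) + cmod (f n) * cmod (g m - g n)"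
        by (metis norm_mult norm_triangle_ineq)
      also have "\<dots> \<le> cmod (f m - f n) * C + B * cmod (g m - g n)"
        by (intro add_mono mult_mono B C) (use B C in auto)
      also have "\<dots> < \<epsilon> / (2 * C) * C + B * (\<epsilon> / (2 * B))"
        using d1(2)[of m n] d2(2)[of m n] that B C
        by (intro add_strict_mono mult_strict_right_mono mult_strict_left_mono) auto
      also have "\<dots> = \<epsilon>" using B C by simp
      finally show ?thesis .
    qed
    then show "\<exists>\<delta>>0. \<forall>m n. d_log m n < \<delta> \<longrightarrow> cmod (f m * g m - f n * g n) < \<epsilon>"
      using d1(1) d2(1) by (intro exI[of _ "min d1 d2"]) auto
  qed
qed

lemma BUC_const: "(\<lambda>k. c) \<in> BUC"
  by (rule BUC_lipschitz[where B="cmod c" and L=0]) auto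

lemma BUC_cmult: "f \<in> BUC \<Longrightarrow> (\<lambda>k. c * f k) \<in> BUC"
  by (rule BUC_mult[OF BUC_const])

lemma BUC_cnj: "f \<in> BUC \<Longrightarrow> (\<lambda>k. cnj (f k)) \<in> BUC"
  unfolding BUC_iff bounded_iff by (simp flip: complex_cnj_diff)

text \<open>A uniform limit inherits at \<epsilon> the \<delta> that an approximant within
  \<epsilon>/3 has at \<epsilon>/3.\<close>

lemma closedin_BUC: "closedin (mtopology_of linf) BUC"
proof -
  have sub: "BUC \<subseteq> mspace linf"
    by (auto simp: BUC_def)
  have "f \<in> BUC" if f: "f \<in> mtopology_of linf closure_of BUC" for f
  proof -
    have fl: "f \<in> mspace linf" using f by (simp add: closure_of_linf)
    then obtain B where "\<And>k. cmod (f k) \<le> B"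
      by (auto simp: mspace_linf bounded_iff)
    then show ?thesis
    proof (rule BUC_I)
      fix \<epsilon> :: real assume e: "\<epsilon> > 0"
      then obtain g where g: "g \<in> BUC" "mdist linf f g < \<epsilon> / 3"
        using f unfolding closure_of_linf by (auto dest!: spec[of _ "\<epsilon> / 3"])
      obtain d where d: "d > 0" "\<And>m n. d_log m n < d \<Longrightarrow> cmod (g m - g n) < \<epsilon> / 3"
        using g(1) e unfolding BUC_iff by (meson divide_pos_pos zero_less_numeral)
      have fg: "cmod (f k - g k) < \<epsilon> / 3" for k
        using cmod_diff_le_mdist_linf[OF fl, of g k] g sub by force
      have "cmod (f m - f n) < \<epsilon>" if "d_log m n < d" for m n
      proof -
        have "f m - f n = (f m - g m) + (g m - g n) - (f n - g n)" by simp
        also have "cmod \<dots> \<le> cmod (f m - g m) + cmod (g m - g n) + cmod (f n - g n)"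
          by (metis add_right_mono norm_triangle_ineq norm_triangle_ineq4 order_trans)
        also have "\<dots> < \<epsilon>" using fg[of m] fg[of n] d(2)[OF that] by simp
        finally show ?thesis .
      qed
      then show "\<exists>\<delta>>0. \<forall>m n. d_log m n < \<delta> \<longrightarrow> cmod (f m - f n) < \<epsilon>"
        using d(1) by blast
    qed
  qed
  then show ?thesis
    using sub by (metis closure_of_eq closure_of_subset subsetI subset_antisym topspace_mtopology_of)
qed

lemma cstar_subalgebra_BUC: "cstar_subalgebra BUC"
  unfolding cstar_subalgebra_def
  using BUC_add BUC_mult BUC_cmult BUC_cnj closedin_BUC BUC_const
  by (auto simp: BUC_def)

section \<open>Uniform continuity\<close>

text \<open>The logarithm itself has increments of size at least 1/(2(k+1)), so increments of
  \<open>D\<close> of size L/(k+1) are dominated by 2L times those of the logarithm, and both sides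
  telescope.\<close>

lemma d_log_lipschitz:
  fixes D :: "nat \<Rightarrow> real"
  assumes step: "\<And>k. \<bar>D (Suc k) - D k\<bar> \<le> L / (real k + 1)"
  shows "\<bar>D m - D n\<bar> \<le> 2 * L * d_log m n"
proof -
  have L: "0 \<le> L" using step[of 0] by simp
  have main: "\<bar>D (m + i) - D m\<bar> \<le> 2 * L * (ln (real (m + i) + 1) - ln (real m + 1))" for m i
  proof (induction i)
    case (Suc i)
    define x where "x = real (m + i) + 1"
    have x: "x \<ge> 1" by (simp add: x_def)
    \<comment> \<open>Inverting the quotient turns the upper bound ln y \<le> y - 1 into the lower
      bound that is wanted.\<close>
    have "ln (x + 1) - ln x = - ln (x / (x + 1))"
      using x by (simp add: ln_div)
    moreover have "ln (x / (x + 1)) \<le> x / (x + 1) - 1"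
      using x by (intro ln_le_minus_one) auto
    moreover have "x / (x + 1) - 1 = - (1 / (x + 1))"
      using x by (simp add: field_simps)
    ultimately have "ln (x + 1) - ln x \<ge> 1 / (x + 1)"
      by linarith
    moreover have "1 / (2 * x) \<le> 1 / (x + 1)"
      using x by (intro divide_left_mono) auto
    ultimately have ln: "1 / (2 * x) \<le> ln (x + 1) - ln x" by simp
    have "\<bar>D (Suc (m + i)) - D (m + i)\<bar> \<le> L / x"
      using step[of "m + i"] by (simp add: x_def)
    also have "\<dots> = 2 * L * (1 / (2 * x))" by simp
    also have "\<dots> \<le> 2 * L * (ln (x + 1) - ln x)"
      using L ln by (intro mult_left_mono) auto
    finally have "\<bar>D (m + Suc i) - D m\<bar> \<le>
        2 * L * (ln (real (m + i) + 1) - ln (real m + 1)) + 2 * L * (ln (x + 1) - ln x)"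
      using Suc.IH by simp
    also have "\<dots> = 2 * L * (ln (real (m + Suc i) + 1) - ln (real m + 1))"
      by (simp add: x_def algebra_simps)
    finally show ?case .
  qed simp
  show ?thesis
  proof (cases "m \<le> n")
    case True
    then have "\<bar>D m - D n\<bar> \<le> 2 * L * (ln (real n + 1) - ln (real m + 1))"
      using main[of m "n - m"] by (simp add: abs_minus_commute)
    also have "\<dots> \<le> 2 * L * d_log m n"
      using L by (intro mult_left_mono) (auto simp: d_log_def)
    finally show ?thesis .
  next
    case False
    then have "\<bar>D m - D n\<bar> \<le> 2 * L * (ln (real m + 1) - ln (real n + 1))"
      using main[of n "m - n"] by simp
    also have "\<dots> \<le> 2 * L * d_log m n"
      using L by (intro mult_left_mono) (auto simp: d_log_def)
    finally show ?thesis .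
  qed
qed

section \<open>Moments of measures with bounded \<open>kappa\<close>\<close>

text \<open>The full series is the differentiated geometric series at 1/e. Only a bound uniform in
  \<open>k\<close> matters: it sums the layer estimates in \<open>moment_bound\<close>.\<close>

lemma sum_exp_weight_le:
  "\<exists>S\<ge>0. \<forall>k. (\<Sum>j\<le>k. exp (- real j) * (real j + 1)) \<le> S"
proof -
  have "(\<lambda>n. of_nat (Suc n) * exp (-1::real) ^ n) sums (1 / (1 - exp (-1))\<^sup>2)"
    by (rule geometric_deriv_sums) simp
  then have s: "(\<lambda>j. exp (- real j) * (real j + 1)) sums (1 / (1 - exp (-1))\<^sup>2)"
    by (simp add: mult.commute add.commute flip: exp_of_nat_mult)
  have "(\<Sum>j\<le>k. exp (- real j) * (real j + 1)) \<le> 1 / (1 - exp (-1))\<^sup>2" for k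
    unfolding sums_unique[OF s] using sums_summable[OF s] by (rule sum_le_suminf) auto
  then show ?thesis
    by (intro exI[of _ "1 / (1 - exp (-1))\<^sup>2"]) auto
qed

text \<open>Cut [0,1) into layers of width 1/(k+1), counted from the endpoint 1. On layer j one has
  r \<le> 1 - j/(k+1) \<le> exp(-j/(k+1)), and the exponent 2k is at least k+1, which gives exp(-j).
  The majorant uses intervals reaching up to 1 rather than the layers themselves, since these are
  the sets whose mass \<open>kappa\<close> controls.\<close>

lemma power_le_sum_indicator:
  fixes r :: real
  assumes r: "0 \<le> r" "r < 1"
  shows "r ^ (2 * k) \<le>
    (\<Sum>j\<le>k. exp (- real j) * indicator {1 - (real j + 1) / (real k + 1)..<1} r)"
proof -
  \<comment> \<open>Ceiling minus one puts r in the layer j < (1 - r)(k+1) \<le> j+1, whose left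
    endpoint in r is included, in agreement with the closed end of the indicator interval.\<close>
  define j where "j = nat (\<lceil>(1 - r) * (real k + 1)\<rceil> - 1)"
  have pos: "0 < (1 - r) * (real k + 1)"
    using r by simp
  then have "0 < \<lceil>(1 - r) * (real k + 1)\<rceil>" by simp
  then have jc: "real j + 1 = of_int \<lceil>(1 - r) * (real k + 1)\<rceil>"
    by (simp add: j_def)
  have lo: "(1 - r) * (real k + 1) \<le> real j + 1"
    unfolding jc by simp
  have hi: "real j < (1 - r) * (real k + 1)"
    using jc ceiling_correct[of "(1 - r) * (real k + 1)"] by linarith
  have "(1 - r) * (real k + 1) \<le> 1 * (real k + 1)"
    using r by (intro mult_right_mono) auto
  then have "real j < real (Suc k)"
    using less_le_trans[OF hi] by (simp add: add.commute)
  then have jk: "j \<le> k" unfolding of_nat_less_iff by simp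
  have ind: "r \<in> {1 - (real j + 1) / (real k + 1)..<1}"
    using lo r by (simp add: field_simps)
  have "r ^ (2 * k) \<le> exp (- real j)"
  \<comment> \<open>The inequality 2k/(k+1) \<ge> 1 fails only for k = 0, and there j = 0 and both
    sides are 1.\<close>
  proof (cases "k = 0")
    case True
    then show ?thesis using jk by simp
  next
    case False
    have "r \<le> 1 - real j / (real k + 1)"
      using hi by (simp add: field_simps)
    also have "\<dots> \<le> exp (- (real j / (real k + 1)))"
      using exp_ge_add_one_self[of "- (real j / (real k + 1))"] by simp
    finally have "r ^ (2 * k) \<le> exp (- (real j / (real k + 1))) ^ (2 * k)"
      using r by (intro power_mono) auto
    also have "\<dots> = exp (- (real j * (2 * real k / (real k + 1))))"
      by (simp flip: exp_of_nat_mult add: field_simps)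
    also have "\<dots> \<le> exp (- (real j * 1))"
      using False by (intro exp_mono le_imp_neg_le mult_left_mono) (auto simp: field_simps)
    finally show ?thesis by simp
  qed
  also have "\<dots> = exp (- real j) * indicator {1 - (real j + 1) / (real k + 1)..<1} r"
    using ind by simp
  also have "\<dots> \<le> (\<Sum>j\<le>k. exp (- real j) * indicator {1 - (real j + 1) / (real k + 1)..<1} r)"
    using jk by (intro member_le_sum) auto
  finally show ?thesis .
qed

lemma space_positive_finite_borel01: "positive_finite_borel01 \<mu> \<Longrightarrow> space \<mu> = {0..<1}"
  using sets_eq_imp_space_eq[of \<mu> borel01]
  by (simp add: positive_finite_borel01_def space_restrict_space)

lemma integrable_power_borel01:
  assumes "positive_finite_borel01 \<mu>"
  shows "integrable \<mu> (\<lambda>r::real. r ^ n)"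
proof -
  interpret finite_measure \<mu> using assms by (simp add: positive_finite_borel01_def)
  have sets: "sets \<mu> = sets borel01" using assms by (simp add: positive_finite_borel01_def)
  have "(\<lambda>r::real. r ^ n) \<in> borel_measurable borel01"
    by (intro measurable_restrict_space1) simp
  then have "(\<lambda>r::real. r ^ n) \<in> borel_measurable \<mu>"
    using sets by (simp cong: measurable_cong_sets)
  then show ?thesis
    using space_positive_finite_borel01[OF assms]
    by (intro integrable_const_bound[where B=1]) (auto simp: power_le_one)
qed

text \<open>Bounded \<open>kappa\<close> means that [r,1) has mass at most K(1 - r). The j-th
  interval of the layer majorant has length (j+1)/(k+1), hence mass at most K(j+1)/(k+1), and the
  weights exp(-j) make the sum over j converge.\<close>

lemma moment_bound:
  assumes p: "positive_finite_borel01 \<mu>" and b: "bounded (kappa \<mu> ` {0..<1})"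
  shows "\<exists>C\<ge>0. \<forall>k. (real k + 1) * (LINT r|\<mu>. r ^ (2 * k)) \<le> C"
proof -
  interpret finite_measure \<mu> using p by (simp add: positive_finite_borel01_def)
  have sets: "sets \<mu> = sets borel01" using p by (simp add: positive_finite_borel01_def)
  obtain K where K: "K > 0" "\<And>r. r \<in> {0..<1} \<Longrightarrow> \<bar>kappa \<mu> r\<bar> \<le> K"
    using b unfolding bounded_pos by auto
  \<comment> \<open>The 2 in \<open>kappa\<close> cancels against 1 + r \<le> 2 in 1 - r^2 = (1 -
    r)(1 + r).\<close>
  have tail: "measure \<mu> {r..<1} \<le> K * (1 - r)" if r: "0 \<le> r" "r < 1" for r
  proof -
    have r2: "0 < 1 - r\<^sup>2" using r by (simp add: power_less_one_iff abs_square_less_1)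
    have "2 * measure \<mu> {r..<1} / (1 - r\<^sup>2) \<le> K"
      using abs_ge_self[of "kappa \<mu> r"] K(2)[of r] r by (simp add: kappa_def del: abs_divide abs_mult)
    then have "2 * measure \<mu> {r..<1} \<le> K * (1 - r\<^sup>2)"
      using r2 by (simp add: field_simps)
    also have "\<dots> = K * (1 - r) * (1 + r)" by (simp add: power2_eq_square algebra_simps)
    also have "\<dots> \<le> K * (1 - r) * 2"
      using r K by (intro mult_left_mono) auto
    finally show ?thesis by simp
  qed
  obtain S where S: "S \<ge> 0" "\<And>k. (\<Sum>j\<le>k. exp (- real j) * (real j + 1)) \<le> S"
    using sum_exp_weight_le by blast
  have "(real k + 1) * (LINT r|\<mu>. r ^ (2 * k)) \<le> K * S" for k
  proof -
    define a where "a j = 1 - (real j + 1) / (real k + 1)" for j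
    have a: "0 \<le> a j" "a j < 1" if "j \<le> k" for j
      using that by (auto simp: a_def field_simps)
    have a_sets: "{a j..<1} \<in> sets \<mu>" if "j \<le> k" for j
      using a[OF that] sets by (auto simp: sets_restrict_space_iff)
    have int: "integrable \<mu> (\<lambda>r. exp (- real j) * indicator {a j..<1} r :: real)" if "j \<le> k" for j
      using a_sets[OF that] by (intro integrable_mult_right integrable_real_indicator)
        (auto simp: emeasure_eq_measure)
    have "(LINT r|\<mu>. r ^ (2 * k)) \<le> (LINT r|\<mu>. (\<Sum>j\<le>k. exp (- real j) * indicator {a j..<1} r))"
    proof (intro integral_mono integrable_power_borel01 p Bochner_Integration.integrable_sum int)
      fix r assume "r \<in> space \<mu>"
      then show "r ^ (2 * k) \<le> (\<Sum>j\<le>k. exp (- real j) * indicator {a j..<1} r)"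
        unfolding a_def using space_positive_finite_borel01[OF p]
        by (intro power_le_sum_indicator) auto
    qed simp
    also have "\<dots> = (\<Sum>j\<le>k. LINT r|\<mu>. exp (- real j) * indicator {a j..<1} r)"
      using int by (intro Bochner_Integration.integral_sum) auto
    also have "\<dots> = (\<Sum>j\<le>k. exp (- real j) * measure \<mu> {a j..<1})"
    proof (intro sum.cong refl)
      fix j assume "j \<in> {..k}"
      then have "{a j..<1} \<inter> space \<mu> = {a j..<1}"
        using sets.Int_space_eq2[OF a_sets] by auto
      then show "(LINT r|\<mu>. exp (- real j) * indicator {a j..<1} r) = exp (- real j) * measure \<mu> {a j..<1}"
        by simp
    qed
    also have "\<dots> \<le> (\<Sum>j\<le>k. exp (- real j) * (K * (1 - a j)))"
      using a tail by (intro sum_mono mult_left_mono) auto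
    also have "\<dots> = K / (real k + 1) * (\<Sum>j\<le>k. exp (- real j) * (real j + 1))"
      by (simp add: a_def sum_distrib_left mult_ac)
    also have "\<dots> \<le> K / (real k + 1) * S"
      using S K by (intro mult_left_mono) auto
    finally show ?thesis by (simp add: field_simps)
  qed
  then show ?thesis using K S by (intro exI[of _ "K * S"]) auto
qed

text \<open>The decrements of a convex sequence decrease, so the last of about $k/2$ of them is at most
  their mean.\<close>

lemma moment_decrement_bound:
  fixes M :: "nat \<Rightarrow> real"
  assumes nonneg: "\<And>k. 0 \<le> M k" and C: "\<And>k. (real k + 1) * M k \<le> C"
    and convex: "\<And>k. M (Suc k) - M (Suc (Suc k)) \<le> M k - M (Suc k)"
  shows "(real k + 1)\<^sup>2 * (M k - M (Suc k)) \<le> 4 * C"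
proof -
  define d where "d k = M k - M (Suc k)" for k
  have dec: "d j \<le> d i" if "i \<le> j" for i j
    using lift_Suc_antimono_le[of d, OF _ that] convex by (auto simp: d_def)
  define m where "m = k div 2"
  \<comment> \<open>Two factors 2 arise, one from the number of averaged decrements and one from
    replacing m+1 by k+1; their product is the 4 in the conclusion.\<close>
  have mk: "m \<le> k" "real k + 1 \<le> 2 * (real k + 1 - real m)" "real k + 1 \<le> 2 * (real m + 1)"
  proof -
    have "2 * m \<le> k" "k \<le> 2 * m + 1" unfolding m_def by simp_all
    then have "2 * real m \<le> real k" "real k \<le> 2 * real m + 1" by linarith+
    then show "m \<le> k" "real k + 1 \<le> 2 * (real k + 1 - real m)" "real k + 1 \<le> 2 * (real m + 1)"
      by auto
  qed
  have C0: "0 \<le> C" using C[of 0] nonneg[of 0] by simp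
  have "(real k + 1 - real m) * d k = (\<Sum>j=m..<Suc k. d k)"
    using mk(1) by (simp add: of_nat_diff)
  also have "\<dots> \<le> (\<Sum>j=m..<Suc k. d j)"
    by (intro sum_mono dec) auto
  also have "\<dots> = M m - M (Suc k)"
    unfolding d_def using mk(1) sum_Suc_diff'[of m "Suc k" "\<lambda>i. - M i"] by simp
  finally have 1: "(real k + 1 - real m) * d k \<le> M m"
    using nonneg[of "Suc k"] by simp
  show ?thesis
  proof (cases "d k \<ge> 0")
    case True
    have "(real k + 1)\<^sup>2 * d k = (real k + 1) * ((real k + 1) * d k)"
      by (simp add: power2_eq_square)
    also have "\<dots> \<le> (2 * (real m + 1)) * ((2 * (real k + 1 - real m)) * d k)"
      using mk True by (intro mult_mono) auto
    also have "\<dots> = 4 * ((real m + 1) * ((real k + 1 - real m) * d k))"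
      by (simp add: algebra_simps)
    also have "\<dots> \<le> 4 * ((real m + 1) * M m)"
      using 1 by (intro mult_left_mono) auto
    also have "\<dots> \<le> 4 * C" using C[of m] by simp
    finally show ?thesis by (simp add: d_def)
  next
    case False
    then have "(real k + 1)\<^sup>2 * d k \<le> 0"
      by (intro mult_nonneg_nonpos) auto
    then show ?thesis using C0 by (simp add: d_def)
  qed
qed

lemma weighted_moment_in_BUC:
  assumes p: "positive_finite_borel01 \<mu>" and b: "bounded (kappa \<mu> ` {0..<1})"
  shows "(\<lambda>k. of_real (2 * (real k + 1) * (LINT r|\<mu>. r ^ (2 * k)))) \<in> BUC"
proof -
  define M where "M k = (LINT r|\<mu>. r ^ (2 * k))" for k
  define D where "D k = 2 * (real k + 1) * M k" for k
  obtain C where C: "C \<ge> 0" "\<And>k. (real k + 1) * M k \<le> C"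
    using moment_bound[OF p b] unfolding M_def by blast
  have int: "integrable \<mu> (\<lambda>r. r ^ n)" for n :: nat
    by (rule integrable_power_borel01[OF p])
  have sp: "space \<mu> = {0..<1}" by (rule space_positive_finite_borel01[OF p])
  have M0: "0 \<le> M k" for k
    unfolding M_def using sp by (intro Bochner_Integration.integral_nonneg) auto
  have dM: "M k - M (Suc k) = (LINT r|\<mu>. r ^ (2 * k) * (1 - r\<^sup>2))" for k
  proof -
    have "M k - M (Suc k) = (LINT r|\<mu>. r ^ (2 * k) - r ^ (2 * Suc k))"
      unfolding M_def using int by (intro Bochner_Integration.integral_diff[symmetric])
    also have "\<dots> = (LINT r|\<mu>. r ^ (2 * k) * (1 - r\<^sup>2))"
      by (simp add: algebra_simps power2_eq_square)
    finally show ?thesis .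
  qed
  have intd: "integrable \<mu> (\<lambda>r. r ^ (2 * k) * (1 - r\<^sup>2))" for k
  proof -
    have "integrable \<mu> (\<lambda>r. r ^ (2 * k) - r ^ (2 * k + 2))"
      using int by (intro Bochner_Integration.integrable_diff)
    then show ?thesis by (simp add: algebra_simps power_add power2_eq_square)
  qed
  have d0: "0 \<le> M k - M (Suc k)" for k
    unfolding dM using sp
    by (intro Bochner_Integration.integral_nonneg) (auto simp: power_le_one)
  \<comment> \<open>The decrement integrates r^(2k) (1 - r^2), which decreases in \<open>k\<close>
    pointwise.\<close>
  have convex: "M (Suc k) - M (Suc (Suc k)) \<le> M k - M (Suc k)" for k
    unfolding dM using sp
    by (intro integral_mono intd mult_right_mono power_decreasing) (auto simp: power_le_one)
  have dec: "(real k + 1)\<^sup>2 * (M k - M (Suc k)) \<le> 4 * C" for k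
    by (rule moment_decrement_bound[OF M0 C(2) convex])
  have step: "\<bar>D (Suc k) - D k\<bar> \<le> (10 * C) / (real k + 1)" for k
  proof -
    define N where "N = real k + 1"
    have N: "N \<ge> 1" by (simp add: N_def)
    \<comment> \<open>The first term comes from the growth of the weight, the second from the decay
      of the moment. They are at most 2C/N and 8C/N, whence the constant 10.\<close>
    have "D (Suc k) - D k = 2 * M (Suc k) - 2 * (N * (M k - M (Suc k)))"
      by (simp add: D_def N_def algebra_simps)
    moreover have "N * (M k - M (Suc k)) \<le> 4 * C / N"
      using dec[of k] N by (simp add: N_def field_simps power2_eq_square)
    moreover have "0 \<le> N * (M k - M (Suc k))" using N d0[of k] by simp
    moreover have "M (Suc k) \<le> C / N"
    proof -
      have "M (Suc k) \<le> M k" using d0[of k] by simp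
      also have "\<dots> \<le> C / N" using C(2)[of k] N by (simp add: N_def field_simps)
      finally show ?thesis .
    qed
    ultimately have "\<bar>D (Suc k) - D k\<bar> \<le> 2 * (C / N) + 2 * (4 * C / N)"
      using M0[of "Suc k"] by linarith
    then show ?thesis by (simp add: N_def)
  qed
  have "(\<lambda>k. complex_of_real (D k)) \<in> BUC"
  proof (rule BUC_lipschitz)
    show "cmod (complex_of_real (D k)) \<le> 2 * C" for k
      using C(2)[of k] M0[of k] unfolding norm_of_real by (simp add: D_def algebra_simps)
    show "cmod (complex_of_real (D m) - complex_of_real (D n)) \<le> (2 * (10 * C)) * d_log m n" for m n
      using d_log_lipschitz[of D, OF step, of m n] by (simp flip: of_real_diff)
  qed
  then show ?thesis by (simp add: D_def M_def)
qed

lemma borel_measurable_power_borel01: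
  "(\<lambda>r. complex_of_real (r ^ n)) \<in> borel_measurable borel01"
  by (intro measurable_restrict_space1) simp

lemma bounded_power_borel01: "bounded ((\<lambda>r. complex_of_real (r ^ n)) ` {0..<1})"
  unfolding bounded_iff by (auto simp: norm_power power_le_one intro!: exI[of _ 1])

lemma gamma_seq_in_BUC:
  assumes "\<eta> \<in> M_C"
  shows "gamma_seq \<eta> \<in> BUC"
proof -
  obtain \<eta>1 \<eta>2 \<eta>3 \<eta>4 where dec: "decomposes \<eta> \<eta>1 \<eta>2 \<eta>3 \<eta>4"
    and b: "\<forall>\<mu>\<in>{\<eta>1, \<eta>2, \<eta>3, \<eta>4}. bounded (kappa \<mu> ` {0..<1})"
    using assms unfolding M_C_def by blast
  define D where "D \<mu> k = complex_of_real (2 * (real k + 1) * (LINT r|\<mu>. r ^ (2 * k)))" for \<mu> k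
  have D: "D \<mu> \<in> BUC" if "\<mu> \<in> {\<eta>1, \<eta>2, \<eta>3, \<eta>4}" for \<mu>
    using weighted_moment_in_BUC[of \<mu>] that b dec unfolding D_def decomposes_def by blast
  have "gamma_seq \<eta> = (\<lambda>k. D \<eta>1 k + (-1) * D \<eta>2 k + \<i> * (D \<eta>3 k + (-1) * D \<eta>4 k))"
    unfolding gamma_seq_def D_def
      complex_integral_eq[OF dec borel_measurable_power_borel01 bounded_power_borel01]
    by (simp add: fun_eq_iff algebra_simps flip: integral_complex_of_real of_real_power)
  also have "\<dots> \<in> BUC"
    by (intro BUC_add BUC_cmult D) auto
  finally show ?thesis .
qed

section \<open>Measures with bounded density\<close>

abbreviation lborel01 :: "real measure"
  where "lborel01 \<equiv> restrict_space lborel {0..<1}"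

lemma sets_lborel01: "sets lborel01 = sets borel01"
  by (rule sets_restrict_space_cong) simp

lemma emeasure_lborel01:
  assumes "0 \<le> r" "r \<le> 1"
  shows "emeasure lborel01 {r..<1} = ennreal (1 - r)"
  using assms by (subst emeasure_restrict_space) auto

lemma finite_measure_lborel01: "finite_measure lborel01"
  by (rule finite_measureI) (use emeasure_lborel01[of 0] in \<open>simp add: space_restrict_space\<close>)

lemma borel_measurable_lborel01: "f \<in> borel_measurable borel \<Longrightarrow> f \<in> borel_measurable lborel01"
  by (intro measurable_restrict_space1) simp

lemma integrable_lborel01:
  fixes f :: "real \<Rightarrow> 'a::{banach, second_countable_topology}"
  assumes "f \<in> borel_measurable borel" "\<And>x. 0 \<le> x \<Longrightarrow> x < 1 \<Longrightarrow> norm (f x) \<le> B"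
  shows "integrable lborel01 f"
  using assms
  by (intro finite_measure.integrable_const_bound[OF finite_measure_lborel01, where B=B]
      borel_measurable_lborel01) (auto simp: space_restrict_space)

text \<open>The mass of [r,1) is at most \<bar>B\<bar>(1 - r) \<le> \<bar>B\<bar>(1 - r^2), so
  \<open>kappa\<close> stays below 2\<bar>B\<bar>. An upper bound on \<open>a\<close> suffices
  because \<open>ennreal\<close> sends negative values to 0.\<close>

lemma density_borel01:
  assumes a: "a \<in> borel_measurable borel" and B: "\<And>x. a x \<le> B"
  defines "\<mu> \<equiv> density lborel01 (\<lambda>x. ennreal (a x))"
  shows "positive_finite_borel01 \<mu>" "bounded (kappa \<mu> ` {0..<1})"
proof -
  have am: "(\<lambda>x. ennreal (a x)) \<in> borel_measurable lborel01"
    using a by (intro borel_measurable_lborel01) simp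
  have sets: "sets \<mu> = sets borel01" by (simp add: \<mu>_def sets_lborel01)
  have em: "emeasure \<mu> {r..<1} \<le> ennreal (\<bar>B\<bar> * (1 - r))" if r: "0 \<le> r" "r < 1" for r
  proof -
    have r_sets: "{r..<1} \<in> sets lborel01"
      using r by (auto simp: sets_restrict_space_iff)
    then have "emeasure \<mu> {r..<1} = (\<integral>\<^sup>+x. ennreal (a x) * indicator {r..<1} x \<partial>lborel01)"
      unfolding \<mu>_def by (rule emeasure_density[OF am])
    also have "\<dots> \<le> (\<integral>\<^sup>+x. ennreal \<bar>B\<bar> * indicator {r..<1} x \<partial>lborel01)"
      using B by (intro nn_integral_mono mult_right_mono ennreal_leI) (auto intro: order_trans[OF _ abs_ge_self])
    also have "\<dots> = ennreal \<bar>B\<bar> * emeasure lborel01 {r..<1}"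
      using r_sets by (rule nn_integral_cmult_indicator)
    finally show ?thesis using r by (simp add: emeasure_lborel01 ennreal_mult)
  qed
  have sp: "space \<mu> = {0..<1}" by (simp add: \<mu>_def space_restrict_space)
  have "emeasure \<mu> (space \<mu>) < top"
    unfolding sp by (rule le_less_trans[OF em]) auto
  then show p: "positive_finite_borel01 \<mu>"
    unfolding positive_finite_borel01_def by (auto simp: sets intro!: finite_measureI)
  have "\<bar>kappa \<mu> r\<bar> \<le> 2 * \<bar>B\<bar>" if r: "0 \<le> r" "r < 1" for r
  proof -
    have "measure \<mu> {r..<1} \<le> \<bar>B\<bar> * (1 - r)"
      using em[OF r] r by (simp add: measure_def enn2real_leI)
    moreover have "1 - r \<le> 1 - r\<^sup>2"
      using r by (simp add: power2_eq_square mult_left_le)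
    moreover have "0 < 1 - r\<^sup>2"
      using r by (simp add: power_less_one_iff abs_square_less_1)
    ultimately have "measure \<mu> {r..<1} / (1 - r\<^sup>2) \<le> \<bar>B\<bar>"
      by (smt (verit) abs_ge_zero mult_left_mono pos_divide_le_eq)
    then show ?thesis
      using \<open>0 < 1 - r\<^sup>2\<close> by (simp add: kappa_def)
  qed
  then show "bounded (kappa \<mu> ` {0..<1})"
    by (intro boundedI[where B="2 * \<bar>B\<bar>"]) auto
qed

lemma measure_sums:
  assumes "positive_finite_borel01 \<mu>" "range A \<subseteq> sets borel01" "disjoint_family A"
  shows "(\<lambda>i. complex_of_real (measure \<mu> (A i))) sums of_real (measure \<mu> (\<Union>i. A i))"
proof -
  interpret finite_measure \<mu> using assms(1) by (simp add: positive_finite_borel01_def)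
  show ?thesis
    using assms by (intro sums_of_real finite_measure_UNION) (auto simp: positive_finite_borel01_def)
qed

text \<open>The positive and negative parts of Re \<alpha> and Im \<alpha> are bounded by the
  modulus of \<alpha>, so they are densities of four admissible positive measures.\<close>

lemma gamma_seq_density:
  fixes \<alpha> :: "real \<Rightarrow> complex"
  assumes m: "\<alpha> \<in> borel_measurable borel" and B: "\<And>x. cmod (\<alpha> x) \<le> B"
  shows "\<exists>\<eta>\<in>M_C. \<forall>k. gamma_seq \<eta> k =
    2 * (of_nat k + 1) * (LINT r|lborel01. of_real (r ^ (2 * k)) * \<alpha> r)"
proof -
  define a1 where "a1 x = max 0 (Re (\<alpha> x))" for x
  define a2 where "a2 x = max 0 (- Re (\<alpha> x))" for x
  define a3 where "a3 x = max 0 (Im (\<alpha> x))" for x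
  define a4 where "a4 x = max 0 (- Im (\<alpha> x))" for x
  note adefs = a1_def a2_def a3_def a4_def
  define dm where "dm a = density lborel01 (\<lambda>x. ennreal (a x))" for a :: "real \<Rightarrow> real"
  have "a1 \<in> borel_measurable borel" "a2 \<in> borel_measurable borel"
    "a3 \<in> borel_measurable borel" "a4 \<in> borel_measurable borel"
    unfolding adefs using m by measurable
  then have am: "a \<in> borel_measurable borel" if "a \<in> {a1, a2, a3, a4}" for a
    using that by auto
  have aB: "0 \<le> a x" "a x \<le> B" if "a \<in> {a1, a2, a3, a4}" for a x
    using that B[of x] abs_Re_le_cmod[of "\<alpha> x"] abs_Im_le_cmod[of "\<alpha> x"] norm_ge_zero[of "\<alpha> x"]
    unfolding adefs by (auto simp: max_def)
  have p: "positive_finite_borel01 (dm a)" "bounded (kappa (dm a) ` {0..<1})"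
    if "a \<in> {a1, a2, a3, a4}" for a
    unfolding dm_def using density_borel01[OF am[OF that] aB(2)[OF that]] .
  \<comment> \<open>The value 0 off the sigma-algebra is the normalisation demanded by
    \<open>complex_borel01\<close>.\<close>
  define \<eta> where "\<eta> A = (if A \<in> sets borel01 then
       of_real (measure (dm a1) A) - of_real (measure (dm a2) A) +
       \<i> * (of_real (measure (dm a3) A) - of_real (measure (dm a4) A)) else 0)" for A
  have dec: "decomposes \<eta> (dm a1) (dm a2) (dm a3) (dm a4)"
    unfolding decomposes_def using p by (simp add: \<eta>_def)
  have "complex_borel01 \<eta>"
    unfolding complex_borel01_def
  proof (intro conjI allI impI; (elim conjE)?)
    fix A :: "nat \<Rightarrow> real set"
    assume A: "range A \<subseteq> sets borel01" "disjoint_family A"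
    then have "A i \<in> sets borel01" "(\<Union>i. A i) \<in> sets borel01" for i
      by (auto intro!: sets.countable_UN)
    then show "(\<lambda>i. \<eta> (A i)) sums \<eta> (\<Union>i. A i)"
      using p A by (simp add: \<eta>_def)
        (intro sums_add sums_diff sums_mult measure_sums; simp)
  qed (simp add: \<eta>_def)
  then have "\<eta> \<in> M_C"
    unfolding M_C_def using dec p by blast
  moreover have "gamma_seq \<eta> k =
    2 * (of_nat k + 1) * (LINT r|lborel01. of_real (r ^ (2 * k)) * \<alpha> r)" for k
  proof -
    have bd: "\<bar>r ^ (2 * k)\<bar> * \<bar>a r\<bar> \<le> 1 * B" if "a \<in> {a1, a2, a3, a4}" "0 \<le> r" "r < 1" for a r
      using that aB by (intro mult_mono) (auto simp: power_le_one)
    have int: "integrable lborel01 (\<lambda>r. complex_of_real (r ^ (2 * k) * a r))"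
      if "a \<in> {a1, a2, a3, a4}" for a
      using am[OF that] bd[OF that]
      by (intro integrable_lborel01[where B=B]) (auto simp: abs_mult simp del: of_real_mult of_real_power)
    have I: "(LINT r|dm a. complex_of_real (r ^ (2 * k))) =
        (LINT r|lborel01. complex_of_real (r ^ (2 * k) * a r))" if "a \<in> {a1, a2, a3, a4}" for a
      unfolding dm_def
      using am[OF that] aB[OF that]
      by (subst integral_density) (auto intro!: borel_measurable_lborel01 simp: scaleR_conv_of_real mult.commute)
    have "complex_integral \<eta> (\<lambda>r. of_real (r ^ (2 * k))) =
      (LINT r|lborel01. complex_of_real (r ^ (2 * k) * a1 r)) -
      (LINT r|lborel01. complex_of_real (r ^ (2 * k) * a2 r)) +
      \<i> * ((LINT r|lborel01. complex_of_real (r ^ (2 * k) * a3 r)) -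
      (LINT r|lborel01. complex_of_real (r ^ (2 * k) * a4 r)))"
      using complex_integral_eq[OF dec borel_measurable_power_borel01 bounded_power_borel01, of "2 * k"]
      by (simp only: I insertI1 insertI2)
    also have "\<dots> = (LINT r|lborel01. complex_of_real (r ^ (2 * k) * a1 r) -
      complex_of_real (r ^ (2 * k) * a2 r) + \<i> * (complex_of_real (r ^ (2 * k) * a3 r) -
      complex_of_real (r ^ (2 * k) * a4 r)))"
      using int by (simp del: of_real_mult of_real_power)
    also have "\<dots> = (LINT r|lborel01. of_real (r ^ (2 * k)) * \<alpha> r)"
    proof (intro Bochner_Integration.integral_cong refl)
      fix r
      have \<alpha>: "\<alpha> r = complex_of_real (a1 r) - of_real (a2 r) + \<i> * (of_real (a3 r) - of_real (a4 r))"
        by (simp add: complex_eq_iff adefs max_def)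
      show "complex_of_real (r ^ (2 * k) * a1 r) -
      complex_of_real (r ^ (2 * k) * a2 r) + \<i> * (complex_of_real (r ^ (2 * k) * a3 r) -
      complex_of_real (r ^ (2 * k) * a4 r)) = of_real (r ^ (2 * k)) * \<alpha> r"
        unfolding \<alpha> by (simp add: algebra_simps)
    qed
    finally show ?thesis by (simp add: gamma_seq_def)
  qed
  ultimately show ?thesis by blast
qed

section \<open>Change of variables and polynomial kernels\<close>

text \<open>Passes to the open interval, where r powr q is differentiable for every q > 0; the
  endpoint 0 is negligible.\<close>

lemma integral_lborel01_eq_integral:
  fixes f :: "real \<Rightarrow> complex"
  assumes "integrable lborel01 f"
  shows "(LINT x|lborel01. f x) = integral {0<..<1} f"
proof -
  have "set_integrable lborel {0..<1} f"
    using assms by (simp add: integrable_restrict_space set_integrable_def)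
  then have "(LINT x|lborel01. f x) = integral {0..<1} f"
    using set_borel_integral_eq_integral(2)[of "{0..<1}" f]
    by (simp add: integral_restrict_space set_lebesgue_integral_def)
  also have "\<dots> = integral {0<..<1} f"
  proof (rule integral_subset_negligible[symmetric])
    have "{0..<1} - {0<..<1} \<subseteq> {0::real}" by auto
    then show "negligible ({0..<1} - {0<..<1::real})"
      using negligible_subset negligible_sing by blast
  qed auto
  finally show ?thesis .
qed

text \<open>The map r powr q is a smooth increasing bijection of (0,1). Integrability on the left is
  assumed because for q < 1 the Jacobian is unbounded near 0, so that the bound on \<open>g\<close>
  does not give it directly.\<close>

lemma integral_lborel01_substitute_powr:
  fixes g :: "real \<Rightarrow> complex"
  assumes q: "q > 0" and g: "g \<in> borel_measurable borel" "\<And>x. cmod (g x) \<le> B"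
    and int: "integrable lborel01 (\<lambda>r. (q * r powr (q - 1)) *\<^sub>R g (r powr q))"
  shows "(LINT r|lborel01. (q * r powr (q - 1)) *\<^sub>R g (r powr q)) = (LINT v|lborel01. g v)"
proof -
  have intg: "integrable lborel01 g"
    using g by (intro integrable_lborel01[where B=B])
  have img: "(\<lambda>r. r powr q) ` {0<..<1} = {0<..<1::real}"
  proof (intro equalityI subsetI)
    fix v :: real assume v: "v \<in> {0<..<1}"
    then have "v = (v powr (1 / q)) powr q" "v powr (1 / q) \<in> {0<..<1}"
      using q powr_less_mono2[of "1 / q" v 1] by (auto simp: powr_powr)
    then show "v \<in> (\<lambda>r. r powr q) ` {0<..<1}" by blast
  qed (use q powr_less_mono2[of q _ 1] in auto)
  have inj: "inj_on (\<lambda>r. r powr q) {0<..<1::real}"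
  proof (rule linorder_inj_onI)
    fix x y :: real assume "x < y" "x \<in> {0<..<1}"
    then have "x powr q < y powr q" using q by (intro powr_less_mono2) auto
    then show "x powr q \<noteq> y powr q" by simp
  qed auto
  have "g absolutely_integrable_on {0<..<1}"
  proof -
    have "set_integrable lborel {0..<1} g"
      using intg by (simp add: integrable_restrict_space set_integrable_def)
    then have "set_integrable lborel {0<..<1} g"
      by (rule set_integrable_subset) auto
    then show ?thesis
      by (simp add: set_integrable_def integrable_completion)
  qed
  moreover have "((\<lambda>r. r powr q) has_field_derivative q * x powr (q - 1)) (at x within {0<..<1})"
    if "x \<in> {0<..<1}" for x
    using that by (intro has_field_derivative_at_within[OF has_real_derivative_powr]) simp
  ultimately have "integral {0<..<1} (\<lambda>r. \<bar>q * r powr (q - 1)\<bar> *\<^sub>R g (r powr q)) = integral {0<..<1} g"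
    using has_absolute_integral_change_of_variables_real
      [of "{0<..<1}" "\<lambda>r. r powr q" "\<lambda>r. q * r powr (q - 1)" g "integral {0<..<1} g"] inj
    unfolding img by auto
  moreover have "integral {0<..<1} (\<lambda>r. \<bar>q * r powr (q - 1)\<bar> *\<^sub>R g (r powr q)) =
      integral {0<..<1} (\<lambda>r. (q * r powr (q - 1)) *\<^sub>R g (r powr q))"
    using q by (intro Henstock_Kurzweil_Integration.integral_cong) simp
  ultimately show ?thesis
    by (simp add: integral_lborel01_eq_integral[OF int] integral_lborel01_eq_integral[OF intg])
qed

text \<open>The exponent q = 2(k+1)/(j+1) is fixed by q(j+1) = 2(k+1): the Jacobian times v^j
  becomes q r^(2k+1), and ln v/(k+1) becomes 2 ln r/(j+1). Hence the factor besides r^(2k) depends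
  on \<open>j\<close> alone, which is what allows one measure for all \<open>k\<close>.\<close>

lemma integral_lborel01_substitute:
  fixes h :: "real \<Rightarrow> complex"
  assumes h: "h \<in> borel_measurable borel" "\<And>x. cmod (h x) \<le> B"
  shows "2 * (of_nat k + 1) *
      (LINT r|lborel01. of_real (r ^ (2 * k)) * (of_real (r / (real j + 1)) * h (- 2 * ln r / (real j + 1)))) =
    (LINT v|lborel01. of_real (v ^ j) * h (- ln v / (real k + 1)))"
proof -
  define q where "q = 2 * (real k + 1) / (real j + 1)"
  have q: "q > 0" by (simp add: q_def)
  \<comment> \<open>Truncated so that it is bounded on the whole line.\<close>
  define g where "g v = of_real (max 0 (min 1 v) ^ j) * h (- ln v / (real k + 1))" for v
  have B0: "0 \<le> B" using norm_ge_zero h(2) by (rule order_trans)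
  have gm: "g \<in> borel_measurable borel"
    unfolding g_def using h(1) by measurable
  have gB: "cmod (g v) \<le> B" for v
  proof -
    have "\<bar>max 0 (min 1 v) ^ j\<bar> * cmod (h (- ln v / (real k + 1))) \<le> 1 * B"
      using h(2) by (intro mult_mono) (auto simp: power_le_one power_abs)
    then show ?thesis by (simp only: g_def norm_mult norm_of_real)
  qed
  have point: "(q * r powr (q - 1)) *\<^sub>R g (r powr q) = 2 * (of_nat k + 1) *
      (of_real (r ^ (2 * k)) * (of_real (r / (real j + 1)) * h (- 2 * ln r / (real j + 1))))"
    if r: "0 \<le> r" "r < 1" for r
  \<comment> \<open>At r = 0 both sides vanish, since \<open>0 powr (q - 1)\<close> is 0 by
    convention and the right side has a factor r.\<close>
  proof (cases "r = 0")
    case False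
    then have r0: "0 < r" using r by simp
    have "r powr q \<le> 1" using r q r0 by (simp add: powr_le1)
    then have mm: "max 0 (min 1 (r powr q)) = r powr q" by simp
    have "q * r powr (q - 1) * (r powr q) ^ j = q * r powr (q - 1 + q * real j)"
      using r0 by (simp add: powr_add powr_powr flip: powr_realpow)
    also have "q - 1 + q * real j = real (2 * k + 1)"
    proof -
      have "q * (real j + 1) = 2 * (real k + 1)" by (simp add: q_def)
      then show ?thesis by (simp add: algebra_simps)
    qed
    also have "q * r powr (real (2 * k + 1)) = 2 * (real k + 1) * (r ^ (2 * k) * (r / (real j + 1)))"
      unfolding powr_realpow[OF r0] by (simp add: q_def)
    finally have c: "q * r powr (q - 1) * (r powr q) ^ j = 2 * (real k + 1) * (r ^ (2 * k) * (r / (real j + 1)))" .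
    have l: "- ln (r powr q) / (real k + 1) = - 2 * ln r / (real j + 1)"
    proof -
      have "q / (real k + 1) = 2 / (real j + 1)"
        unfolding q_def by (auto simp: divide_simps)
      then have "- (q / (real k + 1)) * ln r = - (2 / (real j + 1)) * ln r" by simp
      then show ?thesis using r0 by (simp add: ln_powr)
    qed
    have "(q * r powr (q - 1)) *\<^sub>R g (r powr q) =
        of_real (q * r powr (q - 1) * (r powr q) ^ j) * h (- 2 * ln r / (real j + 1))"
      unfolding g_def mm l by (simp add: scaleR_conv_of_real)
    then show ?thesis unfolding c by simp
  qed simp
  define F where "F r = complex_of_real (r ^ (2 * k)) * (of_real (r / (real j + 1)) * h (- 2 * ln r / (real j + 1)))" for r
  have "F \<in> borel_measurable borel" unfolding F_def using h(1) by measurable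
  moreover have "cmod (F r) \<le> B" if "0 \<le> r" "r < 1" for r
  proof -
    have "\<bar>r ^ (2 * k)\<bar> * (\<bar>r / (real j + 1)\<bar> * cmod (h (- 2 * ln r / (real j + 1)))) \<le> 1 * (1 * B)"
      using h(2) that B0 by (intro mult_mono) (auto simp: power_le_one)
    then show ?thesis by (simp only: F_def norm_mult norm_of_real mult_1)
  qed
  ultimately have intF: "integrable lborel01 F" by (intro integrable_lborel01)
  have cong: "(q * r powr (q - 1)) *\<^sub>R g (r powr q) = 2 * (of_nat k + 1) * F r"
    if "r \<in> space lborel01" for r
    using that point by (simp add: space_restrict_space F_def)
  have int: "integrable lborel01 (\<lambda>r. (q * r powr (q - 1)) *\<^sub>R g (r powr q))"
    using intF by (subst Bochner_Integration.integrable_cong[OF refl cong]) auto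
  have "2 * (of_nat k + 1) * (LINT r|lborel01. F r) = (LINT r|lborel01. (q * r powr (q - 1)) *\<^sub>R g (r powr q))"
    by (subst Bochner_Integration.integral_cong[OF refl cong]) auto
  also have "\<dots> = (LINT v|lborel01. g v)"
    by (rule integral_lborel01_substitute_powr[OF q gm gB int])
  also have "\<dots> = (LINT v|lborel01. of_real (v ^ j) * h (- ln v / (real k + 1)))"
    by (intro Bochner_Integration.integral_cong) (auto simp: g_def space_restrict_space)
  finally show ?thesis by (simp add: F_def)
qed

text \<open>Every monomial of \<open>p\<close> is produced by its own summand of the density; there
  are finitely many, so the density stays bounded.\<close>

lemma gamma_seq_polynomial_kernel:
  fixes h :: "real \<Rightarrow> complex" and p :: "real poly"
  assumes h: "h \<in> borel_measurable borel" "\<And>x. cmod (h x) \<le> B"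
  shows "\<exists>\<eta>\<in>M_C. \<forall>k. gamma_seq \<eta> k =
    (LINT v|lborel01. of_real (poly p v) * h (- ln v / (real k + 1)))"
proof -
  have B0: "0 \<le> B" using norm_ge_zero h(2) by (rule order_trans)
  define \<beta> where "\<beta> j r = complex_of_real (r / (real j + 1)) * h (- 2 * ln r / (real j + 1))" for j r
  \<comment> \<open>Cut off outside [0,1) because r/(j+1) is unbounded on the line while
    \<open>gamma_seq_density\<close> asks for a global bound.\<close>
  define \<alpha> where "\<alpha> r = (if r \<in> {0..<1} then \<Sum>j\<le>degree p. of_real (coeff p j) * \<beta> j r else 0)" for r
  have \<beta>m: "\<beta> j \<in> borel_measurable borel" for j
    unfolding \<beta>_def using h(1) by measurable
  have \<beta>B: "cmod (\<beta> j r) \<le> B" if "0 \<le> r" "r < 1" for j r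
  proof -
    have "\<bar>r / (real j + 1)\<bar> * cmod (h (- 2 * ln r / (real j + 1))) \<le> 1 * B"
      using h(2) that B0 by (intro mult_mono) auto
    then show ?thesis by (simp only: \<beta>_def norm_mult norm_of_real mult_1)
  qed
  have \<alpha>m: "\<alpha> \<in> borel_measurable borel"
    unfolding \<alpha>_def using \<beta>m by measurable
  have \<alpha>B: "cmod (\<alpha> r) \<le> (\<Sum>j\<le>degree p. \<bar>coeff p j\<bar> * B)" for r
    using \<beta>B B0 by (auto simp: \<alpha>_def norm_mult intro!: sum_norm_le mult_left_mono sum_nonneg)
  obtain \<eta> where \<eta>: "\<eta> \<in> M_C" "\<And>k. gamma_seq \<eta> k =
    2 * (of_nat k + 1) * (LINT r|lborel01. of_real (r ^ (2 * k)) * \<alpha> r)"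
    using gamma_seq_density[OF \<alpha>m \<alpha>B] by blast
  have "gamma_seq \<eta> k = (LINT v|lborel01. of_real (poly p v) * h (- ln v / (real k + 1)))" for k
  proof -
    have int1: "integrable lborel01 (\<lambda>r. of_real (r ^ (2 * k)) * \<beta> j r)" for j
    proof (rule integrable_lborel01[where B=B])
      fix r :: real assume r: "0 \<le> r" "r < 1"
      have "\<bar>r ^ (2 * k)\<bar> * cmod (\<beta> j r) \<le> 1 * B"
        using r \<beta>B by (intro mult_mono) (auto simp: power_le_one)
      then show "cmod (of_real (r ^ (2 * k)) * \<beta> j r) \<le> B"
        by (simp only: norm_mult norm_of_real mult_1)
    qed (use \<beta>m in measurable)
    have int2: "integrable lborel01 (\<lambda>v. complex_of_real (v ^ j) * h (- ln v / (real k + 1)))" for j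
    proof (rule integrable_lborel01[where B=B])
      fix r :: real assume r: "0 \<le> r" "r < 1"
      have "\<bar>r ^ j\<bar> * cmod (h (- ln r / (real k + 1))) \<le> 1 * B"
        using r h(2) by (intro mult_mono) (auto simp: power_le_one)
      then show "cmod (complex_of_real (r ^ j) * h (- ln r / (real k + 1))) \<le> B"
        by (simp only: norm_mult norm_of_real mult_1)
    qed (use h(1) in measurable)
    have "(LINT r|lborel01. of_real (r ^ (2 * k)) * \<alpha> r) =
        (LINT r|lborel01. (\<Sum>j\<le>degree p. of_real (coeff p j) * (of_real (r ^ (2 * k)) * \<beta> j r)))"
      by (intro Bochner_Integration.integral_cong)
        (auto simp: \<alpha>_def space_restrict_space sum_distrib_left mult_ac)
    also have "\<dots> = (\<Sum>j\<le>degree p. of_real (coeff p j) * (LINT r|lborel01. of_real (r ^ (2 * k)) * \<beta> j r))"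
      using int1 by (subst Bochner_Integration.integral_sum) auto
    finally have "gamma_seq \<eta> k = (\<Sum>j\<le>degree p. of_real (coeff p j) *
        (2 * (of_nat k + 1) * (LINT r|lborel01. of_real (r ^ (2 * k)) * \<beta> j r)))"
      by (simp add: \<eta>(2) sum_distrib_left mult_ac)
    also have "\<dots> = (\<Sum>j\<le>degree p. of_real (coeff p j) *
        (LINT v|lborel01. of_real (v ^ j) * h (- ln v / (real k + 1))))"
      unfolding \<beta>_def integral_lborel01_substitute[OF h] ..
    also have "\<dots> = (LINT v|lborel01. (\<Sum>j\<le>degree p. of_real (coeff p j) * (of_real (v ^ j) * h (- ln v / (real k + 1)))))"
      using int2 by (subst Bochner_Integration.integral_sum) auto
    also have "\<dots> = (LINT v|lborel01. of_real (poly p v) * h (- ln v / (real k + 1)))"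
      by (intro Bochner_Integration.integral_cong refl)
        (simp add: poly_altdef sum_distrib_left mult_ac)
    finally show ?thesis .
  qed
  then show ?thesis using \<eta>(1) by blast
qed

section \<open>Density\<close>

text \<open>At distance at least \<delta> from c the base of the power is at most \<open>a\<close>,
  while on an interval of length \<rho> beside c it is at least \<open>b > a\<close>. The tail is
  thus at most a^n and the total mass at least b^n \<rho>, so after normalisation the tail is at
  most (a/b)^n/\<rho>, which tends to 0.\<close>

lemma landau_kernel:
  fixes c \<delta> \<epsilon> :: real
  assumes c: "0 < c" "c < 1" and \<delta>: "\<delta> > 0" and \<epsilon>: "\<epsilon> > 0"
  obtains p :: "real poly" where
    "\<And>v. 0 \<le> v \<Longrightarrow> v < 1 \<Longrightarrow> 0 \<le> poly p v"
    "(LINT v|lborel01. poly p v) = 1"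
    "(LINT v|lborel01. poly p v * indicator {v. \<delta> \<le> \<bar>v - c\<bar>} v) \<le> \<epsilon>"
proof -
  \<comment> \<open>Below \<delta> so that \<open>a < b\<close>, and at most 1 - c so that the
    interval to the right of c stays inside [0,1).\<close>
  define \<rho> where "\<rho> = min (\<delta> / 2) (1 - c)"
  have \<rho>: "0 < \<rho>" "\<rho> < \<delta>" "\<rho> < 1" "c + \<rho> \<le> 1"
    using c \<delta> by (auto simp: \<rho>_def)
  \<comment> \<open>Since \<delta> may exceed 1, the maximum keeps the base of the power
    nonnegative.\<close>
  define a where "a = max 0 (1 - \<delta>\<^sup>2)"
  define b where "b = 1 - \<rho>\<^sup>2"
  have b: "0 < b"
    using \<rho> by (simp add: b_def power_less_one_iff abs_square_less_1)
  have ab: "0 \<le> a" "a < b"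
    using b \<rho> by (auto simp: a_def b_def power_strict_mono)
  have "(\<lambda>n. (a / b) ^ n / \<rho>) \<longlonglongrightarrow> 0 / \<rho>"
    using ab b by (intro tendsto_divide LIMSEQ_power_zero tendsto_const) (use \<rho> in auto)
  then have "eventually (\<lambda>n. (a / b) ^ n / \<rho> < \<epsilon>) sequentially"
    using \<epsilon> by (auto dest: order_tendstoD(2))
  then obtain n where n: "(a / b) ^ n / \<rho> < \<epsilon>"
    by (auto simp: eventually_sequentially)
  \<comment> \<open>A Landau kernel: $q(v) = (1 - (v - c)^2)^n$.\<close>
  define q where "q = [:1 - c\<^sup>2, 2 * c, - 1:] ^ n"
  have q: "poly q v = (1 - (v - c)\<^sup>2) ^ n" for v
    by (simp add: q_def poly_power power2_eq_square algebra_simps)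
  have base: "0 \<le> 1 - (v - c)\<^sup>2" "1 - (v - c)\<^sup>2 \<le> 1" if "0 \<le> v" "v < 1" for v
    using that c abs_square_le_1[of "v - c"] by auto
  have q0: "0 \<le> poly q v" and q1: "poly q v \<le> 1" if "0 \<le> v" "v < 1" for v
    unfolding q using base[OF that] by (auto simp: power_le_one)
  define I where "I = (LINT v|lborel01. poly q v)"
  have qm: "poly q \<in> borel_measurable borel"
    by (intro borel_measurable_continuous_onI continuous_intros)
  have qi: "integrable lborel01 (poly q)"
    using q0 q1 by (intro integrable_lborel01[where B=1] qm) auto
  have sets: "{c..<c + \<rho>} \<in> sets lborel01"
    using \<rho> c by (auto simp: sets_restrict_space_iff)
  have meas: "measure lborel01 {c..<c + \<rho>} = \<rho>"
    using \<rho> c by (subst measure_restrict_space) auto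
  have intI: "integrable lborel01 (\<lambda>v. b ^ n * indicator {c..<c + \<rho>} v :: real)"
    using sets finite_measure.emeasure_finite[OF finite_measure_lborel01]
    by (intro integrable_mult_right integrable_real_indicator) (auto simp: less_top)
  have "b ^ n * \<rho> = b ^ n * measure lborel01 ({c..<c + \<rho>} \<inter> space lborel01)"
    using sets.Int_space_eq2[OF sets] by (simp add: meas)
  also have "\<dots> = (LINT v|lborel01. b ^ n * indicator {c..<c + \<rho>} v)"
    by simp
  also have "\<dots> \<le> I"
    unfolding I_def
  proof (intro integral_mono intI qi)
    fix v assume "v \<in> space lborel01"
    then have v: "0 \<le> v" "v < 1" by (auto simp: space_restrict_space)
    show "b ^ n * indicator {c..<c + \<rho>} v \<le> poly q v"
    proof (cases "v \<in> {c..<c + \<rho>}")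
      case True
      then have "(v - c)\<^sup>2 \<le> \<rho>\<^sup>2" by (intro power_mono) auto
      then show ?thesis
        using True b by (auto simp: q b_def intro!: power_mono)
    qed (use q0[OF v] in simp)
  qed
  finally have I: "b ^ n * \<rho> \<le> I" .
  have I0: "0 < I" using I b \<rho> by (smt (verit) mult_pos_pos zero_less_power)
  define p where "p = smult (1 / I) q"
  show ?thesis
  proof
    show "0 \<le> poly p v" if "0 \<le> v" "v < 1" for v
      using q0[OF that] I0 by (simp add: p_def)
    show "(LINT v|lborel01. poly p v) = 1"
      using I0 by (simp add: p_def I_def)
    have "(LINT v|lborel01. poly q v * indicator {v. \<delta> \<le> \<bar>v - c\<bar>} v) \<le> (LINT v|lborel01. a ^ n)"
    proof (rule integral_mono)
      show "integrable lborel01 (\<lambda>v. poly q v * indicator {v. \<delta> \<le> \<bar>v - c\<bar>} v)"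
        using q0 q1 by (intro integrable_lborel01[where B=1] borel_measurable_times qm)
          (auto simp: indicator_def)
      show "integrable lborel01 (\<lambda>v. a ^ n)"
        by (rule integrable_lborel01) auto
      fix v assume "v \<in> space lborel01"
      then have v: "0 \<le> v" "v < 1" by (auto simp: space_restrict_space)
      show "poly q v * indicator {v. \<delta> \<le> \<bar>v - c\<bar>} v \<le> a ^ n"
      proof (cases "\<delta> \<le> \<bar>v - c\<bar>")
        case True
        then have "\<delta>\<^sup>2 \<le> (v - c)\<^sup>2"
          using power_mono[OF True, of 2] \<delta> by simp
        then show ?thesis
          using True base[OF v] by (auto simp: q a_def intro!: power_mono)
      qed (use ab in simp)
    qed
    also have "\<dots> = a ^ n"
      using emeasure_lborel01[of 0] by (simp add: space_restrict_space measure_def)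
    also have "\<dots> \<le> \<epsilon> * (b ^ n * \<rho>)"
      using n b \<rho> by (simp add: field_simps)
    also have "\<dots> \<le> \<epsilon> * I"
      using I \<epsilon> by simp
    finally show "(LINT v|lborel01. poly p v * indicator {v. \<delta> \<le> \<bar>v - c\<bar>} v) \<le> \<epsilon>"
      using I0 by (simp add: p_def divide_le_eq)
  qed
qed

text \<open>The factor 2 absorbs the rounding error, which vanishes unless $|xN - N| \<ge> 1/2$.\<close>

lemma abs_round_mult_diff_le:
  fixes x :: real and N :: nat
  shows "\<bar>real_of_int (round (x * real N)) - real N\<bar> \<le> 2 * \<bar>x - 1\<bar> * real N"
proof -
  have eq: "\<bar>x * real N - real N\<bar> = \<bar>x - 1\<bar> * real N"
    using abs_mult[of "x - 1" "real N"] by (simp add: left_diff_distrib)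
  have "\<bar>real_of_int (round (x * real N)) - real N\<bar> \<le> 2 * \<bar>x * real N - real N\<bar>"
  proof (cases "\<bar>x * real N - real N\<bar> < 1 / 2")
    case True
    then have "round (x * real N) = int N"
      by (intro round_unique') simp
    then show ?thesis by simp
  next
    case False
    then show ?thesis
      using of_int_round_abs_le[of "x * real N"]
        abs_triangle_ineq[of "real_of_int (round (x * real N)) - x * real N" "x * real N - real N"]
      by simp
  qed
  then show ?thesis by (simp add: eq)
qed

text \<open>With N = k+1 and R the rounded value, the distance is \<bar>ln(R/N)\<bar>, and R/N
  differs from 1 by at most 2\<bar>x - 1\<bar> whatever \<open>k\<close> is. Continuity of ln at 1
  does the rest.\<close>

lemma d_log_round_small:
  assumes \<delta>: "\<delta> > 0"
  obtains \<theta> :: real where "\<theta> > 0"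
    "\<And>x k. \<bar>x - 1\<bar> < \<theta> \<Longrightarrow> d_log (nat (round (x * (real k + 1))) - 1) k < \<delta>"
proof -
  have "isCont ln (1::real)" by (rule isCont_ln) simp
  then obtain s where s: "s > 0" "\<And>y::real. \<bar>y - 1\<bar> < s \<Longrightarrow> \<bar>ln y\<bar> < \<delta>"
    using \<delta> unfolding continuous_at_eps_delta by (force simp: dist_real_def)
  show ?thesis
  \<comment> \<open>The s/2 absorbs the factor 2 of the rounding estimate; the 1/4 forces R > N/2 >
    0, so that neither \<open>nat\<close> nor the subtraction of 1 truncates.\<close>
  proof (rule that[of "min (s / 2) (1 / 4)"])
    show "0 < min (s / 2) (1 / 4)" using s by simp
    fix x k assume x: "\<bar>x - 1\<bar> < min (s / 2) (1 / 4)"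
    define N where "N = real k + 1"
    define R where "R = round (x * N)"
    have N: "N \<ge> 1" by (simp add: N_def)
    have dev: "\<bar>real_of_int R - N\<bar> \<le> 2 * \<bar>x - 1\<bar> * N"
      using abs_round_mult_diff_le[of x "Suc k"] by (simp add: R_def N_def add.commute)
    also have "\<dots> < 1 / 2 * N"
      using x N by (intro mult_strict_right_mono) auto
    finally have R: "real_of_int R > 0" using N by linarith
    then have "R \<ge> 1" by simp
    then have m: "real (nat R - 1) + 1 = real_of_int R" by simp
    have "\<bar>real_of_int R / N - 1\<bar> = \<bar>real_of_int R - N\<bar> / N"
    proof -
      have "real_of_int R / N - 1 = (real_of_int R - N) / N"
        using N by (simp add: diff_divide_distrib)
      then show ?thesis using N by (simp add: abs_divide)
    qed
    also have "\<dots> \<le> 2 * \<bar>x - 1\<bar>"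
      using dev N by (simp add: pos_divide_le_eq)
    also have "\<dots> < s" using x by simp
    finally have "\<bar>ln (real_of_int R / N)\<bar> < \<delta>" by (rule s)
    moreover have "ln (real_of_int R / N) = ln (real_of_int R) - ln N"
      using R N by (simp add: ln_div)
    ultimately have "d_log (nat R - 1) k < \<delta>"
      unfolding d_log_def m by (simp add: N_def)
    then show "d_log (nat (round (x * (real k + 1))) - 1) k < \<delta>"
      by (simp add: R_def N_def)
  qed
qed

text \<open>Stated over a general normed algebra so as to cover both the complex integrand and its
  real majorant in \<open>gamma_seq_approx\<close>.\<close>

lemma integrable_lborel01_mult:
  fixes g :: "real \<Rightarrow> 'a::{real_normed_algebra_1, banach, second_countable_topology}"
  assumes a: "a \<in> borel_measurable borel" "integrable lborel01 a"
    and g: "g \<in> borel_measurable borel" "\<And>v. norm (g v) \<le> C"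
  shows "integrable lborel01 (\<lambda>v. of_real (a v) * g v)"
proof (rule Bochner_Integration.integrable_bound)
  show "integrable lborel01 (\<lambda>v. C * a v)" using a(2) by simp
  show "(\<lambda>v. of_real (a v) * g v) \<in> borel_measurable lborel01"
    using g(1) a(1) by (intro borel_measurable_lborel01) measurable
  have "norm (of_real (a v) * g v) \<le> norm (C * a v)" for v
  proof -
    have "norm (of_real (a v) * g v) \<le> \<bar>a v\<bar> * norm (g v)"
      by (metis norm_mult_ineq norm_of_real)
    also have "\<dots> \<le> \<bar>a v\<bar> * \<bar>C\<bar>"
      using g(2)[of v] by (intro mult_left_mono) auto
    finally show ?thesis
      by (simp add: abs_mult mult.commute)
  qed
  then show "AE v in lborel01. norm (of_real (a v) * g v) \<le> norm (C * a v)"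
    by simp
qed

text \<open>The kernel has mass 1, so the error is the kernel mean of f k - h(-ln v/(k+1)). Near 1/e
  uniform continuity bounds the difference by \<epsilon>/2; far from it the difference is at most 2B
  on kernel mass at most \<epsilon>/(4B), which costs another \<epsilon>/2.\<close>

lemma gamma_seq_approx:
  assumes f: "f \<in> BUC" and \<epsilon>: "\<epsilon> > 0"
  shows "\<exists>\<eta>\<in>M_C. \<forall>k. cmod (f k - gamma_seq \<eta> k) \<le> \<epsilon>"
proof -
  obtain B where B: "B > 0" "\<And>k. cmod (f k) \<le> B"
    using BUC_bounded[OF f] by blast
  obtain \<delta> where \<delta>: "\<delta> > 0" "\<And>m n. d_log m n < \<delta> \<Longrightarrow> cmod (f m - f n) < \<epsilon> / 2"
    using f half_gt_zero[OF \<epsilon>] unfolding BUC_iff by meson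
  obtain \<theta> where \<theta>: "\<theta> > 0"
    "\<And>x k. \<bar>x - 1\<bar> < \<theta> \<Longrightarrow> d_log (nat (round (x * (real k + 1))) - 1) k < \<delta>"
    using d_log_round_small[OF \<delta>(1)] by blast
  define c where "c = exp (- 1 :: real)"
  have c: "0 < c" "c < 1" by (auto simp: c_def)
  \<comment> \<open>This function is the factor x in 1/t = x (k+1) for t = -ln v/(k+1), and it
    equals 1 at v = 1/e.\<close>
  have "isCont (\<lambda>v. - (1 / ln v)) c"
    using c by (intro continuous_intros) (auto simp: c_def)
  then obtain w where w: "w > 0" "\<And>v. \<bar>v - c\<bar> < w \<Longrightarrow> \<bar>- (1 / ln v) - 1\<bar> < \<theta>"
    using \<theta>(1) unfolding continuous_at_eps_delta by (force simp: dist_real_def c_def)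
  have e4: "\<epsilon> / (4 * B) > 0" using \<epsilon> B by simp
  obtain p :: "real poly" where p:
    "\<And>v. 0 \<le> v \<Longrightarrow> v < 1 \<Longrightarrow> 0 \<le> poly p v"
    "(LINT v|lborel01. poly p v) = 1"
    "(LINT v|lborel01. poly p v * indicator {v. w \<le> \<bar>v - c\<bar>} v) \<le> \<epsilon> / (4 * B)"
    using landau_kernel[OF c w(1) e4] by metis
  \<comment> \<open>Whenever the rounded value is not positive, in particular for t \<le> 0 and for
    large t, truncation yields f 0; so \<open>h\<close> is total and keeps the bound of
    \<open>f\<close>.\<close>
  define h where "h t = f (nat (round (1 / t)) - 1)" for t :: real
  have hm: "h \<in> borel_measurable borel"
  proof -
    have "(\<lambda>t::real. nat \<lfloor>1 / t + 1 / 2\<rfloor> - 1) \<in> measurable borel (count_space UNIV)"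
      by measurable
    then show ?thesis
      unfolding h_def round_def by (rule measurable_compose) simp
  qed
  have hB: "cmod (h t) \<le> B" for t by (simp add: h_def B)
  obtain \<eta> where \<eta>: "\<eta> \<in> M_C"
    "\<And>k. gamma_seq \<eta> k = (LINT v|lborel01. of_real (poly p v) * h (- ln v / (real k + 1)))"
    using gamma_seq_polynomial_kernel[OF hm hB] by blast
  have "cmod (f k - gamma_seq \<eta> k) \<le> \<epsilon>" for k
  proof -
    define H where "H v = h (- ln v / (real k + 1))" for v
    define far where "far = {v. w \<le> \<bar>v - c\<bar>}"
    have Hm: "H \<in> borel_measurable borel" unfolding H_def using hm by measurable
    have HB: "cmod (H v) \<le> B" for v by (simp add: H_def hB)
    have pm: "poly p \<in> borel_measurable borel"
      by (intro borel_measurable_continuous_onI continuous_intros)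
    have farm: "far \<in> sets borel"
      unfolding far_def by measurable
    \<comment> \<open>A non-integrable function has integral 0 by convention, whereas this integral
      is 1.\<close>
    have pi: "integrable lborel01 (poly p)"
      using p(2) by (metis not_integrable_integral_eq zero_neq_one)
    note bdd = integrable_lborel01_mult[OF pm pi]
    have close: "cmod (f k - H v) \<le> \<epsilon> / 2 + 2 * B * indicator far v" if "0 \<le> v" "v < 1" for v
    proof (cases "v \<in> far")
      case True
      have "cmod (f k - H v) \<le> B + B"
        using norm_triangle_ineq4[of "f k" "H v"] B(2)[of k] HB[of v] by linarith
      then show ?thesis using True \<epsilon> by simp
    next
      case False
      then have "\<bar>- (1 / ln v) - 1\<bar> < \<theta>" by (intro w) (simp add: far_def)
      then have "d_log (nat (round (- (1 / ln v) * (real k + 1))) - 1) k < \<delta>"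
        by (rule \<theta>)
      moreover have "- (1 / ln v) * (real k + 1) = 1 / (- ln v / (real k + 1))"
        by simp
      ultimately have "cmod (H v - f k) < \<epsilon> / 2"
        unfolding H_def h_def by (intro \<delta>(2)) (simp only:)
      then show ?thesis using False by (simp add: norm_minus_commute)
    qed
    have "f k - gamma_seq \<eta> k =
      (LINT v|lborel01. of_real (poly p v) * f k) - (LINT v|lborel01. of_real (poly p v) * H v)"
      by (simp add: \<eta>(2) p(2) H_def)
    also have "\<dots> = (LINT v|lborel01. of_real (poly p v) * f k - of_real (poly p v) * H v)"
      using bdd[OF Hm HB] bdd[of "\<lambda>v. f k" B] B(2) by simp
    also have "\<dots> = (LINT v|lborel01. of_real (poly p v) * (f k - H v))"
      by (simp add: right_diff_distrib)
    also have "cmod \<dots> \<le> (LINT v|lborel01. poly p v * (\<epsilon> / 2 + 2 * B * indicator far v))"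
    proof (rule Bochner_Integration.integral_norm_bound_integral)
      have "integrable lborel01 (\<lambda>v. of_real (poly p v) * (f k - H v))"
      proof (rule bdd)
        show "(\<lambda>v. f k - H v) \<in> borel_measurable borel" using Hm by measurable
        show "cmod (f k - H v) \<le> B + B" for v
          using norm_triangle_ineq4[of "f k" "H v"] B(2)[of k] HB[of v] by linarith
      qed
      then show "integrable lborel01 (\<lambda>v. of_real (poly p v) * (f k - H v))" .
      have "integrable lborel01 (\<lambda>v. of_real (poly p v) * (\<epsilon> / 2 + 2 * B * indicator far v) :: real)"
        using farm B \<epsilon> by (intro bdd[where C="\<epsilon> / 2 + 2 * B"]) (auto simp: indicator_def)
      then show "integrable lborel01 (\<lambda>v. poly p v * (\<epsilon> / 2 + 2 * B * indicator far v))" by simp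
      show "cmod (of_real (poly p v) * (f k - H v)) \<le> poly p v * (\<epsilon> / 2 + 2 * B * indicator far v)"
        if "v \<in> space lborel01" for v
        using that close[of v] p(1)[of v]
        by (auto simp: norm_mult space_restrict_space intro!: mult_left_mono)
    qed
    also have "\<dots> = (LINT v|lborel01. \<epsilon> / 2 * poly p v + 2 * B * (poly p v * indicator far v))"
      by (simp add: algebra_simps)
    also have "\<dots> = \<epsilon> / 2 * (LINT v|lborel01. poly p v) +
        2 * B * (LINT v|lborel01. poly p v * indicator far v)"
      using pi bdd[of "\<lambda>v. indicator far v :: real" 1] farm
      by (subst Bochner_Integration.integral_add) (auto simp: indicator_def)
    also have "\<dots> \<le> \<epsilon> / 2 * 1 + 2 * B * (\<epsilon> / (4 * B))"
      using p B \<epsilon> unfolding far_def by (intro add_mono mult_left_mono) auto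
    also have "\<dots> = \<epsilon>" using B by simp
    finally show ?thesis .
  qed
  then show ?thesis using \<eta>(1) by blast
qed

section \<open>Density in BUC and the generated C*-algebra\<close>

theorem corollary8p3:
  shows "gamma_seq ` M_C \<subseteq> BUC \<and>
    BUC \<subseteq> mtopology_of linf closure_of (gamma_seq ` M_C) \<and>
    cstar_generated (gamma_seq ` M_C) = BUC"
proof (intro conjI)
  show sub: "gamma_seq ` M_C \<subseteq> BUC"
    using gamma_seq_in_BUC by blast
  show dense: "BUC \<subseteq> mtopology_of linf closure_of (gamma_seq ` M_C)"
  proof
    fix f assume f: "f \<in> BUC"
    have BUC_linf: "BUC \<subseteq> mspace linf" by (auto simp: BUC_def)
    have "\<exists>g\<in>gamma_seq ` M_C. g \<in> mspace linf \<and> mdist linf f g < r" if r: "r > 0" for r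
    proof -
      \<comment> \<open>Half of r, because a pointwise bound passes to the supremum only as a
        non-strict one.\<close>
      obtain \<eta> where \<eta>: "\<eta> \<in> M_C" "\<And>k. cmod (f k - gamma_seq \<eta> k) \<le> r / 2"
        using gamma_seq_approx[OF f half_gt_zero[OF r]] by blast
      have g: "gamma_seq \<eta> \<in> mspace linf"
        using gamma_seq_in_BUC[OF \<eta>(1)] BUC_linf by blast
      have "mdist linf f (gamma_seq \<eta>) \<le> r / 2"
        using f BUC_linf g \<eta>(2) by (intro mdist_linf_le) auto
      then show ?thesis using g \<eta>(1) r by (intro bexI[of _ "gamma_seq \<eta>"]) auto
    qed
    then show "f \<in> mtopology_of linf closure_of (gamma_seq ` M_C)"
      using f BUC_linf by (auto simp: closure_of_linf)
  qed
  show "cstar_generated (gamma_seq ` M_C) = BUC"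
  proof
    show "cstar_generated (gamma_seq ` M_C) \<subseteq> BUC"
      unfolding cstar_generated_def using cstar_subalgebra_BUC sub by blast
    show "BUC \<subseteq> cstar_generated (gamma_seq ` M_C)"
      unfolding cstar_generated_def
    proof (rule Inter_greatest, elim CollectE conjE)
      fix A assume A: "cstar_subalgebra A" "gamma_seq ` M_C \<subseteq> A"
      then have "closedin (mtopology_of linf) A"
        by (simp add: cstar_subalgebra_def)
      then show "BUC \<subseteq> A"
        using dense closure_of_minimal[OF A(2)] by blast
    qed
  qed
qed

end
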